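(* 1) For every integer $t\ge 1$ there exists a constant $c_t>0$ such that for every odd prime power $q=p^t$ ($p$ prime), $$\mathrm{Nikodym}(3,q)\ \le\ q^3-c_t\,q^{2.1167}.$$ 2) There exist an absolute constant $C>0$, an integer $D\ge 3$, and for each integer $d\ge D$ constants $\epsilon_d$ and $c_d>0$ with $\epsilon_d\le C(\log\log d)^{-1}$, such that for every integer $d\ge D$ and every prime power $q=p^t$ ($p$ prime, $t\ge 1$ an integer), $$\mathrm{Nikodym}(d,q)\ \le\ q^d-c_d\,q^{\,d-\epsilon_d-2\log t/\log p}.$$
   Context: For $x\in\mathbb{F}_q^d$ and $v\in\mathbb{F}_q^d\setminus\{0\}$ write $\ell(x,v)^*=\{x+tv: t\in\mathbb{F}_q\}\setminus\{x\}$. A set $N\subset\mathbb{F}_q^d$ is a Nikodym set if for every $x\in\mathbb{F}_q^d$ there exists $v\in\mathbb{F}_q^d\setminus\{0\}$ such that $\ell(x,v)^*\subset N$. $\mathrm{Nikodym}(d,q)$ denotes the size of the smallest Nikodym set in $\mathbb{F}_q^d$. *)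

theory Defs
  imports Complex_Main "HOL-Library.FuncSet" "HOL-Computational_Algebra.Primes" "HOL-Algebra.Ring"
begin

text \<open>The constants in the theorem are uniform over finite fields of varying order, so the field
  has to be quantified inside the formula; it is therefore a \<open>HOL-Algebra\<close> structure rather than a
  type. Every finite field has an isomorphic copy with carrier in \<^typ>\<open>nat\<close>.\<close>

definition is_GF :: "nat \<Rightarrow> nat ring \<Rightarrow> bool" where
  "is_GF q F \<longleftrightarrow> field F \<and> finite (carrier F) \<and> card (carrier F) = q"

text \<open>Vectors are indexed by \<open>0, \<dots>, d - 1\<close> and extensional (\<^const>\<open>undefined\<close> outside
  this range), so that this set has exactly \<open>q ^ d\<close> elements.\<close>

definition vecs :: "('a, 'm) ring_scheme \<Rightarrow> nat \<Rightarrow> (nat \<Rightarrow> 'a) set" where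
  "vecs F d = {..<d} \<rightarrow>\<^sub>E carrier F"

definition zero_vec :: "('a, 'm) ring_scheme \<Rightarrow> nat \<Rightarrow> nat \<Rightarrow> 'a" where
  "zero_vec F d = (\<lambda>i\<in>{..<d}. \<zero>\<^bsub>F\<^esub>)"

definition punctured_line ::
  "('a, 'm) ring_scheme \<Rightarrow> nat \<Rightarrow> (nat \<Rightarrow> 'a) \<Rightarrow> (nat \<Rightarrow> 'a) \<Rightarrow> (nat \<Rightarrow> 'a) set" where
  "punctured_line F d x v =
     {(\<lambda>i\<in>{..<d}. x i \<oplus>\<^bsub>F\<^esub> s \<otimes>\<^bsub>F\<^esub> v i) | s. s \<in> carrier F} - {x}"

definition nikodym_set :: "('a, 'm) ring_scheme \<Rightarrow> nat \<Rightarrow> (nat \<Rightarrow> 'a) set \<Rightarrow> bool" where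
  "nikodym_set F d N \<longleftrightarrow>
     N \<subseteq> vecs F d \<and>
     (\<forall>x\<in>vecs F d. \<exists>v\<in>vecs F d - {zero_vec F d}. punctured_line F d x v \<subseteq> N)"

text \<open>For a finite field and \<open>d \<ge> 1\<close> the whole space is a Nikodym set, so the minimum is attained.
  The value depends only on \<open>d\<close> and the order of the field, finite fields of equal order being
  isomorphic.\<close>

definition nikodym_number :: "nat \<Rightarrow> ('a, 'm) ring_scheme \<Rightarrow> nat" where
  "nikodym_number d F = (LEAST n. \<exists>N. nikodym_set F d N \<and> card N = n)"

end

theory Submission
  imports Defs "HOL-Real_Asymp.Real_Asymp" "HOL-Algebra.Multiplicative_Group"
    "HOL-Number_Theory.Residues" "HOL-Computational_Algebra.Polynomial"
begin

text \<open>
  If every point of a set \<open>P\<close> in \<open>n < d\<close> dimensions has a line meeting \<open>P\<close> only there (a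
  point-line matching), then the complement of \<open>P\<close> times the remaining \<open>d - n\<close> coordinates is a
  Nikodym set: a point outside uses a line in the direction of one of these extra coordinates.

  To build matchings, a field element is written as an integer polynomial of degree less than \<open>t\<close>
  evaluated at a generator, with coefficients in \<open>[0, p)\<close>. The first coordinate is restricted to
  polynomials of smaller degree and size, so that for two points on one of the lines the parameter is
  an integer polynomial \<open>T\<close> and the coordinates change without reduction modulo \<open>p\<close>. A
  polynomial \<open>G\<close> in the coordinates then changes along the line by \<open>T ^ k\<close>, up to
  digits beyond those in use. As in Ruzsa's
  construction of sets without square differences, restrict the base \<open>m\<close> digits of \<open>G\<close> in the
  positions divisible by \<open>k\<close> to a set of residues whose differences are not \<open>k\<close>-th powers:
  the lowest digit of \<open>T ^ k\<close> contradicts this unless \<open>T = 0\<close>.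

  In dimension 2 take \<open>G = x\<^sup>2 - y\<close>, the direction \<open>(1, 2 x)\<close> and 12 residues modulo 205. In
  high dimension take \<open>k = r - 1\<close> for a prime \<open>m = r\<close>, where \<open>k\<close>-th powers are 0 or 1
  and almost half of the residues are allowed, and \<open>G = (\<Sum>j<k. z\<^sub>j x\<^sup>j)\<close>. The direction
  making all intermediate powers of \<open>T\<close> vanish has large entries; splitting every \<open>z\<^sub>j\<close> into
  several coordinates weighted by powers of a small base keeps the entries small, so that the first
  coordinate has to be restricted by a factor \<open>q\<^bsup>O(1/r)\<^esup>\<close> only.
\<close>

section \<open>Integer polynomials representing field elements\<close>

text \<open>The ring homomorphism from Z[X] sending X to \<open>x\<close>, by Horner's scheme. It
  carries type-based polynomials into a carrier-based ring.\<close>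

definition (in ring) int_eval :: "'a \<Rightarrow> int poly \<Rightarrow> 'a" where
  "int_eval x f = fold_coeffs (\<lambda>c y. [c] \<cdot> \<one> \<oplus> x \<otimes> y) f \<zero>"

context cring
begin

lemma int_eval_0 [simp]: "int_eval x 0 = \<zero>"
  by (simp add: int_eval_def)

lemma int_eval_pCons:
  assumes "x \<in> carrier R"
  shows "int_eval x (pCons c f) = [c] \<cdot> \<one> \<oplus> x \<otimes> int_eval x f"
proof (cases "c = 0 \<and> f = 0")
  case True
  then show ?thesis using assms by (simp add: add_pow_def)
next
  case False
  then have "pCons c f \<noteq> 0" by auto
  then show ?thesis by (auto simp: int_eval_def)
qed

lemma add_pow_0_int [simp]: "[(0::int)] \<cdot> a = \<zero>"
  by (simp add: add_pow_def)

lemma add_pow_one_closed [simp]: "[(c::int)] \<cdot> \<one> \<in> carrier R"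
  by (rule add.int_pow_closed) simp

lemma int_eval_closed [simp]:
  assumes x: "x \<in> carrier R"
  shows "int_eval x f \<in> carrier R"
  by (induction f) (auto simp: int_eval_pCons x)

lemma int_eval_const:
  assumes x: "x \<in> carrier R"
  shows "int_eval x [:c:] = [c] \<cdot> \<one>"
  using int_eval_pCons[OF x, of c 0] x by simp

lemma int_eval_1: "x \<in> carrier R \<Longrightarrow> int_eval x 1 = \<one>"
  by (simp add: int_eval_const one_pCons)

lemma int_eval_add:
  assumes x: "x \<in> carrier R"
  shows "int_eval x (f + g) = int_eval x f \<oplus> int_eval x g"
proof (induction f g rule: poly_induct2)
  case (pCons a f b g)
  have "int_eval x (pCons a f + pCons b g) = ([a] \<cdot> \<one> \<oplus> [b] \<cdot> \<one>) \<oplus> (x \<otimes> int_eval x f \<oplus> x \<otimes> int_eval x g)"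
    by (simp add: int_eval_pCons x pCons.IH add.int_pow_mult r_distr)
  also have "\<dots> = int_eval x (pCons a f) \<oplus> int_eval x (pCons b g)"
    by (simp add: int_eval_pCons x a_ac)
  finally show ?case .
qed simp

lemma int_eval_smult:
  assumes x: "x \<in> carrier R"
  shows "int_eval x (smult c f) = ([c] \<cdot> \<one>) \<otimes> int_eval x f"
proof (induction f)
  case (pCons a f)
  have "[(c * a)] \<cdot> \<one> = ([c] \<cdot> \<one>) \<otimes> ([a] \<cdot> \<one>)"
    by (simp add: add_pow_ldistr_int add.int_pow_pow mult.commute)
  then show ?case
    using pCons by (simp add: int_eval_pCons x r_distr m_lcomm)
qed (simp add: x)

lemma int_eval_mult:
  assumes x: "x \<in> carrier R"
  shows "int_eval x (f * g) = int_eval x f \<otimes> int_eval x g"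
proof (induction f)
  case (pCons a f)
  then show ?case
    by (simp add: int_eval_pCons x l_distr int_eval_add int_eval_smult m_assoc mult_pCons_left)
qed (simp add: x)

lemma int_eval_minus:
  assumes x: "x \<in> carrier R"
  shows "int_eval x (- f) = \<ominus> int_eval x f"
proof -
  have "int_eval x (- f) \<oplus> int_eval x f = \<zero>"
    using int_eval_add[OF x, of "-f" f] by simp
  then show ?thesis
    using x by (metis int_eval_closed minus_equality)
qed

lemma int_eval_diff:
  assumes x: "x \<in> carrier R"
  shows "int_eval x (f - g) = int_eval x f \<ominus> int_eval x g"
  using int_eval_add[OF x, of f "- g"] by (simp add: int_eval_minus x a_minus_def)

end

section \<open>Polynomials with digits in a bounded range\<close>

definition box :: "nat \<Rightarrow> nat \<Rightarrow> int poly set" where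
  "box s h = {f. (\<forall>i<s. 0 \<le> coeff f i \<and> coeff f i < int h) \<and> (\<forall>i\<ge>s. coeff f i = 0)}"

lemma bij_betw_box: "bij_betw (\<lambda>f. \<lambda>i\<in>{..<s}. coeff f i) (box s h) ({..<s} \<rightarrow>\<^sub>E {0..<int h})"
proof (rule bij_betw_byWitness[where f' = "\<lambda>c. Poly (map c [0..<s])"])
  have cf: "coeff (Poly (map c [0..<s])) i = (if i < s then c i else 0)" for c :: "nat \<Rightarrow> int" and i
    by (simp add: coeff_Poly_eq nth_default_def)
  show "\<forall>f\<in>box s h. Poly (map (\<lambda>i\<in>{..<s}. coeff f i) [0..<s]) = f"
    by (auto simp: poly_eq_iff cf box_def simp del: coeff_Poly_eq)
  show "\<forall>c\<in>{..<s} \<rightarrow>\<^sub>E {0..<int h}. (\<lambda>i\<in>{..<s}. coeff (Poly (map c [0..<s])) i) = c"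
    by (auto simp: cf fun_eq_iff restrict_def PiE_def extensional_def simp del: coeff_Poly_eq)
  show "(\<lambda>f. \<lambda>i\<in>{..<s}. coeff f i) ` box s h \<subseteq> {..<s} \<rightarrow>\<^sub>E {0..<int h}"
    by (auto simp: box_def split: if_splits)
  show "(\<lambda>c. Poly (map c [0..<s])) ` ({..<s} \<rightarrow>\<^sub>E {0..<int h}) \<subseteq> box s h"
    by (auto simp: box_def cf PiE_def Pi_def simp del: coeff_Poly_eq)
qed

lemma finite_box [simp]: "finite (box s h)"
  using bij_betw_finite[OF bij_betw_box[of s h]] by (simp add: finite_PiE)

lemma card_box [simp]: "card (box s h) = h ^ s"
  using bij_betw_same_card[OF bij_betw_box[of s h]] by (simp add: card_PiE)

section \<open>The kernel of evaluation at a generator\<close>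

context field
begin

text \<open>The additive group has order \<open>p ^ t\<close>, so \<open>p ^ t\<close> times the
  unit vanishes; this is the \<open>t\<close>-th power of \<open>p\<close> times the unit, and a
  field has no nonzero nilpotents.\<close>

lemma char_p_of_card:
  assumes p: "Factorial_Ring.prime (p::nat)" and fin: "finite (carrier R)" and card: "card (carrier R) = p ^ t"
  shows "[int p] \<cdot> \<one> = \<zero>"
proof -
  have "[(p ^ t)] \<cdot> \<one> = \<zero>"
    using add.pow_order_eq_1[of \<one>] card by (simp add: Coset.order_def)
  moreover have "[(p ^ j)] \<cdot> \<one> = ([p] \<cdot> \<one>) [^] (j::nat)" for j
  proof (induction j)
    case (Suc j)
    have "[(p ^ Suc j)] \<cdot> \<one> = [p] \<cdot> ([(p ^ j)] \<cdot> \<one>)"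
      using add.nat_pow_pow[of \<one> p "p ^ j"] by (simp add: mult.commute)
    also have "\<dots> = ([(p ^ j)] \<cdot> \<one>) \<otimes> ([p] \<cdot> \<one>)"
      using add_pow_rdistr[of "[(p ^ j)] \<cdot> \<one>" \<one> p] by simp
    finally show ?case using Suc by simp
  qed simp
  ultimately have "([p] \<cdot> \<one>) [^] t = \<zero>" by simp
  moreover have "\<zero> = u" if "u [^] (j::nat) = \<zero>" "u \<in> carrier R" for u j
    using that by (induction j) (auto simp: integral_iff)
  ultimately have "[p] \<cdot> \<one> = \<zero>" by (metis add.nat_pow_closed one_closed)
  then show ?thesis by (simp add: add_pow_int_ge)
qed

lemma int_eval_p_multiple:
  assumes p: "[int p] \<cdot> \<one> = \<zero>" and x: "x \<in> carrier R" 
    and dvd: "\<And>i. int p dvd coeff f i - coeff g i"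
  shows "int_eval x f = int_eval x g"
proof -
  have "[:int p:] dvd f - g"
    by (simp add: const_poly_dvd_iff dvd)
  then obtain h where "f - g = [:int p:] * h" by (rule dvdE)
  then have "f = g + smult (int p) h" by (simp add: algebra_simps)
  then show ?thesis
    using x p by (simp add: int_eval_add int_eval_smult)
qed

lemma exists_box_rep:
  assumes p: "[int p] \<cdot> \<one> = \<zero>" and p0: "p > 0" and x: "x \<in> carrier R"
    and deg: "\<And>i. i \<ge> s \<Longrightarrow> coeff f i = 0"
  shows "\<exists>g\<in>box s p. int_eval x f = int_eval x g"
proof -
  define g where "g = map_poly (\<lambda>c. c mod int p) f"
  have cg: "coeff g i = coeff f i mod int p" for i
    by (simp add: g_def coeff_map_poly)
  have "g \<in> box s p" using p0 by (auto simp: box_def cg deg)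
  moreover have "int_eval x f = int_eval x g"
    by (rule int_eval_p_multiple[OF p x]) (simp add: cg minus_mod_eq_mult_div)
  ultimately show ?thesis by blast
qed

text \<open>A generator of the multiplicative group is a root of no polynomial of degree less than \<open>t\<close>,
  since otherwise its powers would span fewer than \<open>p ^ t\<close> elements.\<close>

lemma int_eval_kernel:
  assumes p: "Factorial_Ring.prime (p::nat)" and fin: "finite (carrier R)" and card: "card (carrier R) = p ^ t"
  obtains x where "x \<in> carrier R"
    "\<And>f i. int_eval x f = \<zero> \<Longrightarrow> (\<And>j. j \<ge> t \<Longrightarrow> coeff f j = 0) \<Longrightarrow> int p dvd coeff f i"
proof -
  have char: "[int p] \<cdot> \<one> = \<zero>" by (rule char_p_of_card[OF p fin card])
  have p1: "p > 1" using p by (rule prime_gt_1_nat)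
  obtain x where x: "x \<in> carrier R" and gen: "carrier R - {\<zero>} = {x [^] i | i::nat. i \<in> UNIV}"
    using finite_field_mult_group_has_gen[OF fin] by (auto simp: mult_of_simps)
  \<comment> \<open>Induction on a degree bound: a relation of degree \<open>s < t\<close> with
    leading coefficient prime to \<open>p\<close> would make the field too small.\<close>
  have main: "\<forall>f. int_eval x f = \<zero> \<longrightarrow> (\<forall>j\<ge>s. coeff f j = 0) \<longrightarrow> (\<forall>i. int p dvd coeff f i)" if "s \<le> t" for s
    using that
  proof (induction s)
    case 0
    show ?case by auto
  next
    case (Suc s)
    show ?case
    proof (intro allI impI, rule ccontr)
      fix f i
      assume f: "int_eval x f = \<zero>" "\<forall>j\<ge>Suc s. coeff f j = 0" and ndvd: "\<not> int p dvd coeff f i"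
      define c where "c = coeff f s"
      have "\<not> int p dvd c"
      proof
        assume dv: "int p dvd c"
        have ci: "coeff (f - monom c s) j = (if j = s then 0 else coeff f j)" for j
          by (auto simp: c_def coeff_monom)
        have "int_eval x (f - monom c s) = int_eval x f"
          by (rule int_eval_p_multiple[OF char x]) (use dv in \<open>auto simp: ci c_def\<close>)
        moreover have "coeff (f - monom c s) j = 0" if "j \<ge> s" for j
          unfolding ci using f(2) that by auto
        ultimately have "int p dvd coeff (f - monom c s) i" 
          using Suc.IH[OF Suc_leD[OF Suc.prems]] f(1) by (metis (no_types))
        then show False using ndvd dv by (auto simp: ci c_def split: if_splits)
      qed
      then have "coprime (int p) c" using p by (simp add: prime_imp_coprime)
      then obtain a b where ab: "a * int p + b * c = 1"
        by (metis bezout_int coprime_imp_gcd_eq_1)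
      \<comment> \<open>Inverting \<open>c\<close> modulo \<open>p\<close> solves the relation for
        X^s: \<open>h\<close> has degree below \<open>s\<close> and the same value as X^s. The last
        monomial clears the multiple of \<open>p\<close> left in degree \<open>s\<close>.\<close>
      define h where "h = monom 1 s - smult b f + monom (- a * int p) s"
      have h0: "coeff h j = 0" if "j \<ge> s" for j
        using f(2) that ab by (auto simp: h_def coeff_monom c_def algebra_simps)
      have ev_h: "int_eval x h = int_eval x (monom 1 s)"
      proof -
        have "int_eval x h = int_eval x (monom 1 s - smult b f)"
          by (rule int_eval_p_multiple[OF char x]) (auto simp: h_def coeff_monom)
        then show ?thesis using x f(1) by (simp add: int_eval_diff int_eval_smult a_minus_def)
      qed
      define W where "W = {g. \<forall>j\<ge>s. coeff g j = (0::int)}"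
      \<comment> \<open>Multiplication by \<open>x\<close> is a shift; the coefficient
        \<open>b\<close> that it moves to degree \<open>s\<close> is brought back by
        \<open>h\<close>.\<close>
      have step: "\<exists>g'\<in>W. int_eval x g' = x \<otimes> int_eval x g" if g: "g \<in> W" for g
      proof -
        define b where "b = (if s = 0 then 0 else coeff g (s - 1))"
        define g' where "g' = pCons 0 g - smult b (monom 1 s) + smult b h"
        have "int_eval x g' = x \<otimes> int_eval x g"
          using x ev_h
          by (simp add: g'_def int_eval_add int_eval_diff int_eval_smult int_eval_pCons a_minus_def a_assoc l_neg)
        moreover have "g' \<in> W"
          using g h0 by (auto simp: W_def g'_def coeff_pCons coeff_monom b_def split: nat.splits)
        ultimately show ?thesis by blast
      qed
      have one: "\<exists>g\<in>W. int_eval x g = \<one>"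
      proof (cases "s = 0")
        case True
        then have "h = 0" using h0 by (simp add: poly_eq_iff)
        then have "\<one> = \<zero>" using ev_h True x by (simp add: int_eval_1)
        then show ?thesis by simp
      next
        case False
        then have "1 \<in> W" by (auto simp: W_def)
        then show ?thesis using int_eval_1[OF x] by blast
      qed
      have pow: "\<exists>g\<in>W. int_eval x g = x [^] (j::nat)" for j
      proof (induction j)
        case (Suc j)
        then show ?case using step x by (metis nat_pow_Suc m_comm nat_pow_closed)
      qed (use one in simp)
      \<comment> \<open>Every element is zero or a power of \<open>x\<close>, so reduced polynomials
        of degree below \<open>s\<close> represent the whole field, giving
        \<open>p ^ t <= p ^ s\<close>.\<close>
      have "carrier R \<subseteq> int_eval x ` box s p"
      proof
        fix y assume y: "y \<in> carrier R"
        have "\<exists>g\<in>W. int_eval x g = y"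
        proof (cases "y = \<zero>")
          case True
          then show ?thesis by (intro bexI[of _ 0]) (auto simp: W_def)
        next
          case False
          then have "y \<in> {x [^] i | i::nat. i \<in> UNIV}" using y gen by blast
          then show ?thesis using pow by auto
        qed
        then obtain g where "g \<in> W" "int_eval x g = y" by blast
        then show "y \<in> int_eval x ` box s p"
          using exists_box_rep[OF char _ x, of s g] p1 by (auto simp: W_def)
      qed
      then have "p ^ t \<le> card (int_eval x ` box s p)"
        unfolding card[symmetric] by (intro card_mono) auto
      also have "\<dots> \<le> p ^ s" using card_image_le[of "box s p"] by simp
      finally show False using Suc.prems p1 by (simp add: power_increasing_iff)
    qed
  qed
  show thesis by (rule that[OF x]) (use main[of t] in auto)
qed

end

section \<open>Point-line matchings and Nikodym sets\<close>

definition point_line_matching ::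
  "('a, 'm) ring_scheme \<Rightarrow> nat \<Rightarrow> (nat \<Rightarrow> 'a) set \<Rightarrow> bool" where
  "point_line_matching F n P \<longleftrightarrow> P \<subseteq> vecs F n \<and>
     (\<forall>x\<in>P. \<exists>v\<in>vecs F n - {zero_vec F n}. punctured_line F n x v \<inter> P = {})"

lemma nikodym_number_le:
  fixes F :: "('a, 'm) ring_scheme"
  assumes F: "field F" "finite (carrier F)" "card (carrier F) = q"
    and nd: "n < d" and P: "point_line_matching F n P"
  shows "nikodym_number d F + card P * q ^ (d - n) \<le> q ^ d"
proof -
  interpret field F by fact
  define Q where "Q = {x \<in> vecs F d. restrict x {..<n} \<in> P}"
  have PV: "P \<subseteq> vecs F n" using P by (simp add: point_line_matching_def)
  have fin: "finite (vecs F d)" "finite (vecs F n)" using F by (auto simp: vecs_def finite_PiE)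
  have card_V: "card (vecs F d) = q ^ d" using F by (simp add: vecs_def card_PiE)
  have sub: "Q \<subseteq> vecs F d" by (auto simp: Q_def)
  have "nikodym_set F d (vecs F d - Q)"
    unfolding nikodym_set_def
  proof (intro conjI ballI)
    fix x assume x: "x \<in> vecs F d"
    then have xc: "x i \<in> carrier F" if "i < d" for i using that by (auto simp: vecs_def)
    have line_V: "(\<lambda>i\<in>{..<d}. x i \<oplus>\<^bsub>F\<^esub> s \<otimes>\<^bsub>F\<^esub> v i) \<in> vecs F d" if "v \<in> vecs F d" "s \<in> carrier F" for v s
      using x that by (auto simp: vecs_def)
    show "\<exists>v\<in>vecs F d - {zero_vec F d}. punctured_line F d x v \<subseteq> vecs F d - Q"
    proof (cases "x \<in> Q")
      case True
      define x0 where "x0 = restrict x {..<n}"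
      have "x0 \<in> P" using True by (simp add: Q_def x0_def)
      then have "\<exists>v\<in>vecs F n - {zero_vec F n}. punctured_line F n x0 v \<inter> P = {}"
        using P by (simp only: point_line_matching_def)
      then obtain v0 where v0: "v0 \<in> vecs F n" "v0 \<noteq> zero_vec F n" "punctured_line F n x0 v0 \<inter> P = {}"
        by (metis (no_types) DiffE singletonI)
      define v where "v = (\<lambda>i\<in>{..<d}. if i < n then v0 i else \<zero>\<^bsub>F\<^esub>)"
      have v: "v \<in> vecs F d"
        using v0(1) unfolding v_def vecs_def by (intro restrict_PiE_iff[THEN iffD2] ballI) auto
      obtain i0 where "i0 < n" "v0 i0 \<noteq> \<zero>\<^bsub>F\<^esub>"
      proof -
        have "\<exists>i<n. v0 i \<noteq> \<zero>\<^bsub>F\<^esub>"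
        proof (rule ccontr)
          assume "\<not> (\<exists>i<n. v0 i \<noteq> \<zero>\<^bsub>F\<^esub>)"
          then have "v0 = zero_vec F n"
            using v0(1) by (auto simp: vecs_def zero_vec_def fun_eq_iff PiE_def extensional_def)
          then show False using v0(2) by simp
        qed
        then show ?thesis using that by blast
      qed
      then have "v \<noteq> zero_vec F d"
        using nd by (auto simp: v_def zero_vec_def fun_eq_iff intro!: exI[of _ i0])
      moreover have "punctured_line F d x v \<subseteq> vecs F d - Q"
      proof
        fix y assume "y \<in> punctured_line F d x v"
        then obtain s where s: "s \<in> carrier F" "y = (\<lambda>i\<in>{..<d}. x i \<oplus>\<^bsub>F\<^esub> s \<otimes>\<^bsub>F\<^esub> v i)" "y \<noteq> x"
          by (auto simp: punctured_line_def)
        have "y \<notin> Q"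
        proof
          assume "y \<in> Q"
          then have "restrict y {..<n} \<in> P" by (simp add: Q_def)
          moreover have "restrict y {..<n} = (\<lambda>i\<in>{..<n}. x0 i \<oplus>\<^bsub>F\<^esub> s \<otimes>\<^bsub>F\<^esub> v0 i)"
            using nd by (auto simp: s(2) x0_def v_def fun_eq_iff)
          \<comment> \<open>In the first \<open>n\<close> coordinates the line passes through
            \<open>x0\<close> and meets \<open>P\<close> only there; in the others it is constant.
            Hence \<open>y = x\<close>.\<close>
          ultimately have yx: "restrict y {..<n} = x0"
            using v0(3) s(1) by (auto simp: punctured_line_def)
          have "y i = x i" for i
          proof (cases "i < n")
            case True
            then show ?thesis using fun_cong[OF yx, of i] by (simp add: x0_def)
          next
            case False
            then show ?thesis using x s(1) xc[of i] by (cases "i < d") (auto simp: s(2) v_def vecs_def PiE_def extensional_def)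
          qed
          then show False using s(3) by auto
        qed
        then show "y \<in> vecs F d - Q" using line_V[OF v s(1)] s(2) by simp
      qed
      ultimately show ?thesis using v by blast
    next
      case False
      define v where "v = (\<lambda>i\<in>{..<d}. if i = n then \<one>\<^bsub>F\<^esub> else \<zero>\<^bsub>F\<^esub>)"
      have v: "v \<in> vecs F d" by (auto simp: v_def vecs_def)
      have "v \<noteq> zero_vec F d"
        using nd by (auto simp: v_def zero_vec_def fun_eq_iff intro!: exI[of _ n])
      moreover have "punctured_line F d x v \<subseteq> vecs F d - Q"
      proof
        fix y assume "y \<in> punctured_line F d x v"
        then obtain s where s: "s \<in> carrier F" "y = (\<lambda>i\<in>{..<d}. x i \<oplus>\<^bsub>F\<^esub> s \<otimes>\<^bsub>F\<^esub> v i)"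
          by (auto simp: punctured_line_def)
        have "restrict y {..<n} = restrict x {..<n}"
          using nd xc s(1) by (simp add: s(2) v_def fun_eq_iff restrict_def)
        then have "y \<notin> Q" using False x by (simp add: Q_def)
        then show "y \<in> vecs F d - Q" using line_V[OF v s(1)] s(2) by simp
      qed
      ultimately show ?thesis using v by blast
    qed
  qed auto
  then have "nikodym_number d F \<le> card (vecs F d - Q)"
    unfolding nikodym_number_def by (intro Least_le exI[of _ "vecs F d - Q"]) simp
  also have "\<dots> = q ^ d - card Q"
    using card_Diff_subset[of Q "vecs F d"] sub fin card_V finite_subset by metis
  finally have 1: "nikodym_number d F \<le> q ^ d - card Q" .
  define E where "E = (\<lambda>(x, u). \<lambda>i\<in>{..<d}. if i < n then x i else (u i :: 'a))"
  have "card (P \<times> ({n..<d} \<rightarrow>\<^sub>E carrier F)) \<le> card Q"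
  proof (rule card_inj_on_le)
    show "E ` (P \<times> ({n..<d} \<rightarrow>\<^sub>E carrier F)) \<subseteq> Q"
    proof clarify
      fix x u assume x: "x \<in> P" and u: "u \<in> {n..<d} \<rightarrow>\<^sub>E carrier F"
      then have xV: "x \<in> vecs F n" using PV by blast
      have "restrict (E (x, u)) {..<n} = x"
        using xV nd by (auto simp: E_def fun_eq_iff vecs_def PiE_def extensional_def restrict_def)
      moreover have "E (x, u) \<in> vecs F d"
        using PiE_mem[OF xV[unfolded vecs_def]] PiE_mem[OF u] by (auto simp: E_def vecs_def)
      ultimately show "E (x, u) \<in> Q" using x by (simp add: Q_def)
    qed
    show "inj_on E (P \<times> ({n..<d} \<rightarrow>\<^sub>E carrier F))"
    proof (rule inj_onI, clarify)
      fix x u x' u' assume A: "x \<in> P" "u \<in> {n..<d} \<rightarrow>\<^sub>E carrier F" "x' \<in> P" "u' \<in> {n..<d} \<rightarrow>\<^sub>E carrier F"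
        and eq: "E (x, u) = E (x', u')"
      have e: "(if i < n then x i else u i) = (if i < n then x' i else u' i)" if "i < d" for i
        using fun_cong[OF eq, of i] that by (simp add: E_def)
      have xV: "x \<in> vecs F n" "x' \<in> vecs F n" using A PV by auto
      have "x i = x' i" for i
        using e[of i] nd xV by (cases "i < n") (auto simp: vecs_def PiE_def extensional_def)
      moreover have "u i = u' i" for i
        using e[of i] A by (cases "i \<in> {n..<d}") (auto simp: PiE_def extensional_def)
      ultimately show "x = x' \<and> u = u'" by auto
    qed
    show "finite Q" using fin(1) sub finite_subset by blast
  qed
  then have "card P * q ^ (d - n) \<le> card Q"
    using F by (simp add: card_cartesian_product card_PiE)
  moreover have "card Q \<le> q ^ d" using card_mono[OF fin(1) sub] card_V by simp
  ultimately show ?thesis using 1 by linarith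
qed

section \<open>Digits of power differences\<close>

text \<open>For the lowest nonzero coefficient \<open>m ^ j * u\<close> of \<open>T\<close>, at degree \<open>e\<close>, the digit of
  \<open>f\<close> at degree \<open>k * e\<close> and position \<open>k * j\<close> changes by \<open>u ^ k\<close>.\<close>

lemma lowest_digit_conflict:
  fixes T f f' :: "int poly" and R :: "int set" and \<sigma> :: "nat \<Rightarrow> nat \<Rightarrow> int"
  assumes R: "\<And>a b u. a \<in> R \<Longrightarrow> b \<in> R \<Longrightarrow> [b - a = u ^ k] (mod int m) \<Longrightarrow> int m dvd u"
    and k: "k \<ge> 1" and m: "m \<ge> 2"
    and T: "T \<noteq> 0" "\<And>i. i \<ge> D \<Longrightarrow> coeff T i = 0" "\<And>i. \<bar>coeff T i\<bar> < int m ^ L"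
    and f: "\<And>i. i < k * D \<Longrightarrow> int m ^ (k * L) dvd coeff (f' - f - T ^ k) i"
    and dig: "\<And>e j. e < D \<Longrightarrow> j < L \<Longrightarrow> (coeff f (k * e) div int m ^ (k * j) + \<sigma> e j) mod int m \<in> R"
    and dig': "\<And>e j. e < D \<Longrightarrow> j < L \<Longrightarrow> (coeff f' (k * e) div int m ^ (k * j) + \<sigma> e j) mod int m \<in> R"
  shows False
proof -
  define e where "e = (LEAST i. coeff T i \<noteq> 0)"
  have ex: "\<exists>i. coeff T i \<noteq> 0" using T(1) by (auto simp: poly_eq_iff)
  have e: "coeff T e \<noteq> 0" unfolding e_def by (rule LeastI_ex[OF ex])
  have below: "coeff T i = 0" if "i < e" for i
    using not_less_Least[of i "\<lambda>i. coeff T i \<noteq> 0"] that unfolding e_def by blast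
  have eD: "e < D" using T(2) e by (meson not_le)
  define c where "c = coeff T e"
  \<comment> \<open>Splitting off X^e shows that \<open>T ^ k\<close> starts in degree
    \<open>k * e\<close> with coefficient \<open>c ^ k\<close>.\<close>
  have "T = monom 1 e * poly_shift e T"
    by (rule poly_eqI) (use below in \<open>auto simp: coeff_monom_mult coeff_poly_shift\<close>)
  then have "T ^ k = monom 1 (k * e) * poly_shift e T ^ k"
    by (metis (no_types) monom_power mult.commute power_mult_distrib power_one)
  then have Tk: "coeff (T ^ k) (k * e) = c ^ k"
    by (simp add: coeff_monom_mult coeff_0_power coeff_poly_shift c_def)
  \<comment> \<open>The size bound on \<open>T\<close> keeps the exact power of \<open>m\<close>
    dividing \<open>c\<close> below \<open>m ^ L\<close>, so the digit to be compared is a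
    controlled one.\<close>
  have nd: "\<not> int m ^ L dvd c"
    using T(3)[of e] e zdvd_imp_le[of "int m ^ L" "\<bar>c\<bar>"] by (auto simp: c_def)
  define i where "i = (LEAST i. \<not> int m ^ i dvd c)"
  have i: "\<not> int m ^ i dvd c" "i \<le> L" unfolding i_def using LeastI[of "\<lambda>i. \<not> int m ^ i dvd c", OF nd] Least_le[of "\<lambda>i. \<not> int m ^ i dvd c", OF nd] by blast+
  then obtain j where j: "i = Suc j" by (cases i) auto
  have "int m ^ j dvd c" using not_less_Least[of j "\<lambda>i. \<not> int m ^ i dvd c"] j unfolding i_def by simp
  then obtain u where u: "c = int m ^ j * u" by (rule dvdE)
  have mu: "\<not> int m dvd u" using i(1) u j by auto
  have jL: "j < L" using i(2) j by simp
  have "k * e < k * D" using eD k by simp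
  from f[OF this] obtain w where w: "coeff f' (k * e) - coeff f (k * e) - c ^ k = int m ^ (k * L) * w"
    by (auto simp: Tk)
  \<comment> \<open>The error, a multiple of \<open>m ^ (k * L)\<close>, starts at least one digit
    above position \<open>k * j\<close>, so it changes the compared digit by a multiple of
    \<open>m\<close> only.\<close>
  have kL: "k * L = k * j + Suc (k * L - k * j - 1)"
  proof -
    have "k * Suc j \<le> k * L" using jL by (intro mult_le_mono2) simp
    then show ?thesis using k by simp
  qed
  define w' where "w' = int m ^ (k * L - k * j - 1) * w"
  have "int m ^ (k * L) * w = int m ^ (k * j) * (int m * w')"
    unfolding w'_def by (subst kL) (simp add: power_add)
  moreover have "c ^ k = int m ^ (k * j) * u ^ k"
    by (simp add: u power_mult_distrib power_mult[symmetric] mult.commute)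
  ultimately have "coeff f' (k * e) = coeff f (k * e) + int m ^ (k * j) * (u ^ k + int m * w')"
    using w by (simp add: algebra_simps)
  then have "coeff f' (k * e) div int m ^ (k * j) = coeff f (k * e) div int m ^ (k * j) + (u ^ k + int m * w')"
    using m by simp
  then have "[(coeff f' (k * e) div int m ^ (k * j) + \<sigma> e j) mod int m
      - (coeff f (k * e) div int m ^ (k * j) + \<sigma> e j) mod int m = u ^ k] (mod int m)"
    by (simp add: cong_def mod_simps algebra_simps)
  from R[OF dig[OF eD jL] dig'[OF eD jL] this] mu show False by blast
qed

section \<open>Averaging over shifts of the digits\<close>

lemma pigeonhole_average:
  fixes c :: "'a \<Rightarrow> nat"
  assumes "finite A" "A \<noteq> {}" "B \<le> (\<Sum>a\<in>A. c a)"
  obtains a where "a \<in> A" "B \<le> c a * card A"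
proof (rule ccontr)
  assume "\<not> thesis"
  then have "c a * card A < B" if "a \<in> A" for a
    using that \<open>\<And>a. a \<in> A \<Longrightarrow> B \<le> c a * card A \<Longrightarrow> thesis\<close> by (meson not_le)
  then have "(\<Sum>a\<in>A. c a * card A) < (\<Sum>a\<in>A. B)"
    using assms by (intro sum_strict_mono) auto
  then have "(\<Sum>a\<in>A. c a) * card A < B * card A"
    by (simp add: sum_distrib_right[symmetric])
  then show False using assms(3) by simp
qed

text \<open>Each element of \<open>S\<close> is reached from \<open>c\<close> by a shift of its own.
  A random shift thus keeps any given digit with probability at least \<open>card S / m\<close>, so
  nothing needs to be known about the distribution of the digits.\<close>

lemma card_shifts:
  fixes S :: "int set"
  assumes "S \<subseteq> {0..<int m}" 
  shows "card S \<le> card {s \<in> {0..<int m}. (c + s) mod int m \<in> S}"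
proof (rule card_inj_on_le[where f = "\<lambda>a. (a - c) mod int m"])
  show "inj_on (\<lambda>a. (a - c) mod int m) S"
  proof (rule inj_onI)
    fix a b assume ab: "a \<in> S" "b \<in> S" "(a - c) mod int m = (b - c) mod int m"
    then have "int m dvd (a - c) - (b - c)" by (simp only: mod_eq_dvd_iff)
    then have "int m dvd a - b" by simp
    moreover have "\<bar>a - b\<bar> < int m" using subsetD[OF assms ab(1)] subsetD[OF assms ab(2)] by auto
    ultimately show "a = b" using zdvd_imp_le[of "int m" "\<bar>a - b\<bar>"] by auto
  qed
  show "(\<lambda>a. (a - c) mod int m) ` S \<subseteq> {s \<in> {0..<int m}. (c + s) mod int m \<in> S}"
  proof clarify
    fix a assume a: "a \<in> S"
    then have "0 \<le> a" "a < int m" using assms by auto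
    then show "(a - c) mod int m \<in> {0..<int m} \<and> (c + (a - c) mod int m) mod int m \<in> S"
      using a by (simp add: mod_simps)
  qed
qed (rule finite_subset[of _ "{0..<int m}"], auto)

context field
begin

lemma box_int_eval_inj:
  assumes x: "x \<in> carrier R"
    and ker: "\<And>f i. int_eval x f = \<zero> \<Longrightarrow> (\<And>j. j \<ge> t \<Longrightarrow> coeff f j = 0) \<Longrightarrow> int p dvd coeff f i"
    and fg: "f \<in> box s h" "g \<in> box s h" "int_eval x f = int_eval x g" and "s \<le> t" "h \<le> p"
  shows "f = g"
proof (rule poly_eqI)
  fix i
  have "int_eval x (f - g) = \<zero>" using fg(3) x by (simp add: int_eval_diff a_minus_def r_neg)
  then have d: "int p dvd coeff (f - g) i"
    by (rule ker) (use fg \<open>s \<le> t\<close> in \<open>auto simp: box_def\<close>)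
  have "\<bar>coeff f i - coeff g i\<bar> < int p \<or> coeff f i = coeff g i"
    using fg(1,2) \<open>h \<le> p\<close> by (cases "i < s") (force simp: box_def)+
  then show "coeff f i = coeff g i"
    using d zdvd_imp_le[of "int p" "\<bar>coeff f i - coeff g i\<bar>"] by fastforce
qed

text \<open>Common frame for squares and higher powers. Averaging yields shifts
  \<open>\<sigma>\<close> that retain a proportion \<open>(card S / m) ^ (D * L)\<close> of
  \<open>Y\<close>. By \<open>dir\<close> there is a direction along which \<open>G\<close> changes
  by the \<open>k\<close>-th power of the parameter in the digits that matter, so two retained
  points on such a line contradict \<open>lowest_digit_conflict\<close>.\<close>

lemma matching_from_digits:
  fixes N h D t n k L m :: nat and S :: "int set" and G :: "(nat \<Rightarrow> int poly) \<Rightarrow> int poly"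
  defines "Y \<equiv> (\<Pi>\<^sub>E i\<in>{..<n}. if i = 0 then box D N else box t h)"
  assumes x: "x \<in> carrier R"
    and ker: "\<And>f i. int_eval x f = \<zero> \<Longrightarrow> (\<And>j. j \<ge> t \<Longrightarrow> coeff f j = 0) \<Longrightarrow> int p dvd coeff f i"
    and bounds: "D \<le> t" "N \<le> p" "h \<le> p" "n \<ge> 1" "k \<ge> 1" "m \<ge> 2" "N \<le> m ^ L"
    and S: "S \<subseteq> {0..<int m}"
      "\<And>a b u. a \<in> S \<Longrightarrow> b \<in> S \<Longrightarrow> [b - a = u ^ k] (mod int m) \<Longrightarrow> int m dvd u"
    and dir: "\<And>y. y \<in> Y \<Longrightarrow> \<exists>w. w 0 = 1 \<and> (\<forall>y'\<in>Y.
       (\<forall>i<n. int_eval x (y' i - y i - (y' 0 - y 0) * w i) = \<zero>) \<longrightarrow>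
       (\<forall>i<k * D. int m ^ (k * L) dvd coeff (G y' - G y - (y' 0 - y 0) ^ k) i))"
  shows "\<exists>P. point_line_matching R n P \<and>
    N ^ D * h ^ (t * (n - 1)) * card S ^ (D * L) \<le> card P * m ^ (D * L)"
proof -
  define I where "I = {..<D} \<times> {..<L}"
  define \<Sigma>' where "\<Sigma>' = I \<rightarrow>\<^sub>E {0..<int m}"
  define c where "c y e j = coeff (G y) (k * e) div int m ^ (k * j)" for y e j
  define rel where "rel \<sigma> y \<longleftrightarrow> (\<forall>(e, j)\<in>I. (c y e j + \<sigma> (e, j)) mod int m \<in> S)" for \<sigma> y
  have finY: "finite Y" unfolding Y_def by (intro finite_PiE) auto
  have cardY: "card Y = N ^ D * h ^ (t * (n - 1))"
  proof -
    have "card Y = (\<Prod>i<n. if i = 0 then N ^ D else h ^ t)"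
      unfolding Y_def by (subst card_PiE) (auto intro!: prod.cong)
    also obtain n' where n': "n = Suc n'" using bounds by (cases n) auto
    have "(\<Prod>i<n. if i = 0 then N ^ D else h ^ t) = N ^ D * h ^ (t * (n - 1))"
      unfolding n' by (subst prod.lessThan_Suc_shift) (simp add: power_mult)
    finally show ?thesis .
  qed
  have fin\<Sigma>: "finite \<Sigma>'" and card\<Sigma>: "card \<Sigma>' = m ^ (D * L)" and ne\<Sigma>: "\<Sigma>' \<noteq> {}"
    using bounds by (auto simp: \<Sigma>'_def I_def finite_PiE card_PiE card_cartesian_product PiE_eq_empty_iff)
  have many: "card S ^ (D * L) \<le> card {\<sigma> \<in> \<Sigma>'. rel \<sigma> y}" for y
  proof -
    have "{\<sigma> \<in> \<Sigma>'. rel \<sigma> y} = (\<Pi>\<^sub>E ej\<in>I. {s \<in> {0..<int m}. (c y (fst ej) (snd ej) + s) mod int m \<in> S})"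
      unfolding \<Sigma>'_def rel_def by (fastforce simp: PiE_iff)
    then have "card {\<sigma> \<in> \<Sigma>'. rel \<sigma> y} = (\<Prod>ej\<in>I. card {s \<in> {0..<int m}. (c y (fst ej) (snd ej) + s) mod int m \<in> S})"
      by (simp add: card_PiE I_def)
    moreover have "(\<Prod>ej\<in>I. card S) \<le> \<dots>"
      by (intro prod_mono conjI card_shifts[OF S(1)]) simp
    ultimately show ?thesis by (simp add: I_def card_cartesian_product)
  qed
  \<comment> \<open>Double counting of the pairs of a point and an admissible shift vector, followed
    by the choice of a shift vector that is at least average.\<close>
  have "card Y * card S ^ (D * L) \<le> (\<Sum>y\<in>Y. card {\<sigma> \<in> \<Sigma>'. rel \<sigma> y})"
    using sum_mono[of Y "\<lambda>_. card S ^ (D * L)", OF many] by simp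
  also have "\<dots> = (\<Sum>\<sigma>\<in>\<Sigma>'. card {y \<in> Y. rel \<sigma> y})"
    by (rule sum_multicount_gen[symmetric]) (use finY fin\<Sigma> in auto)
  finally obtain \<sigma> where \<sigma>: "\<sigma> \<in> \<Sigma>'" "card Y * card S ^ (D * L) \<le> card {y \<in> Y. rel \<sigma> y} * m ^ (D * L)"
    using pigeonhole_average[OF fin\<Sigma> ne\<Sigma>] unfolding card\<Sigma> by blast
  define Z where "Z = {y \<in> Y. rel \<sigma> y}"
  define V where "V y = (\<lambda>i\<in>{..<n}. int_eval x (y i))" for y
  have inbox: "y i \<in> (if i = 0 then box D N else box t h)" if "y \<in> Y" "i < n" for y i
    using that unfolding Y_def by (auto simp: PiE_iff)
  have inj: "y = y'" if "y \<in> Y" "y' \<in> Y" "V y = V y'" for y y'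
  proof
    fix i
    show "y i = y' i"
    proof (cases "i < n")
      case True
      then have "int_eval x (y i) = int_eval x (y' i)"
        using fun_cong[OF that(3), of i] by (simp add: V_def)
      then show ?thesis
        using box_int_eval_inj[OF x ker, of t "y i" _ _ "y' i"] inbox[OF that(1) True] inbox[OF that(2) True] bounds
        by (metis (no_types, lifting) order_refl)
    next
      case False
      then show ?thesis using that(1,2) by (simp add: Y_def PiE_def extensional_def)
    qed
  qed
  have "card (V ` Z) = card Z"
    by (intro card_image inj_onI inj) (auto simp: Z_def)
  moreover have "point_line_matching R n (V ` Z)"
    unfolding point_line_matching_def
  proof (intro conjI ballI)
    show "V ` Z \<subseteq> vecs R n" using x by (auto simp: V_def vecs_def split: if_splits)
    fix u assume "u \<in> V ` Z"
    then obtain y where y: "y \<in> Y" "rel \<sigma> y" "u = V y" by (auto simp: Z_def)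
    obtain w where w: "w 0 = 1" "\<And>y'. y' \<in> Y \<Longrightarrow>
       (\<And>i. i < n \<Longrightarrow> int_eval x (y' i - y i - (y' 0 - y 0) * w i) = \<zero>) \<Longrightarrow>
       (\<forall>i<k * D. int m ^ (k * L) dvd coeff (G y' - G y - (y' 0 - y 0) ^ k) i)"
      using dir[OF y(1)] by blast
    have "V w \<in> vecs R n" using x by (auto simp: V_def vecs_def split: if_splits)
    moreover have "V w \<noteq> zero_vec R n"
      using bounds x w(1) by (auto simp: V_def zero_vec_def fun_eq_iff int_eval_1 intro!: exI[of _ 0])
    moreover have "punctured_line R n u (V w) \<inter> V ` Z = {}"
    proof (rule ccontr)
      assume "punctured_line R n u (V w) \<inter> V ` Z \<noteq> {}"
      then obtain z where z: "z \<in> punctured_line R n u (V w)" "z \<in> V ` Z" by blast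
      from z(1) obtain s where s: "s \<in> carrier R" "z = (\<lambda>i\<in>{..<n}. u i \<oplus> s \<otimes> V w i)" "z \<noteq> u"
        unfolding punctured_line_def by blast
      from z(2) obtain y' where y': "y' \<in> Y" "rel \<sigma> y'" "z = V y'" by (auto simp: Z_def)
      have neq: "V y' \<noteq> V y" and eq: "V y' = (\<lambda>i\<in>{..<n}. u i \<oplus> s \<otimes> V w i)"
        using s y'(3) y(3) by auto
      have eqi: "int_eval x (y' i) = int_eval x (y i) \<oplus> s \<otimes> int_eval x (w i)" if "i < n" for i
        using fun_cong[OF eq, of i] that by (simp add: V_def y(3))
      define T where "T = y' 0 - y 0"
      \<comment> \<open>Since \<open>w 0 = 1\<close>, the first coordinate identifies the field
        parameter \<open>s\<close> with the value of an integer polynomial of small degree and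
        size.\<close>
      have sT: "s = int_eval x T"
        using eqi[of 0] bounds x s by (simp add: T_def w(1) int_eval_1 int_eval_diff a_minus_def a_ac r_neg1 r_neg)
      have line: "int_eval x (y' i - y i - (y' 0 - y 0) * w i) = \<zero>" if "i < n" for i
      proof -
        define a b where "a = int_eval x (y i)" and "b = s \<otimes> int_eval x (w i)"
        have ab: "a \<in> carrier R" "b \<in> carrier R" using x s by (auto simp: a_def b_def)
        have "int_eval x (y' i - y i - (y' 0 - y 0) * w i) = (a \<oplus> b \<ominus> a) \<ominus> b"
          using eqi[OF that] x
          by (simp add: int_eval_diff int_eval_mult T_def[symmetric] sT[symmetric] a_def[symmetric] b_def[symmetric])
        also have "a \<oplus> b \<ominus> a = b"
          using ab by (simp add: a_minus_def a_comm[of a b] a_assoc r_neg)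
        finally show ?thesis using ab by (simp add: a_minus_def r_neg)
      qed
      have T0: "T \<noteq> 0"
      proof
        assume "T = 0"
        then have "V y' = V y" using eqi x sT by (auto simp: V_def fun_eq_iff)
        then show False using neq by simp
      qed
      have b0: "y 0 \<in> box D N" "y' 0 \<in> box D N"
        using inbox[OF y(1), of 0] inbox[OF y'(1), of 0] bounds by auto
      have Tz: "coeff T i = 0" if "i \<ge> D" for i using b0 that by (simp add: box_def T_def)
      have Tb: "\<bar>coeff T i\<bar> < int m ^ L" for i
      proof -
        have "N > 0 \<or> D = 0" using b0 by (auto simp: box_def)
        moreover have "int N \<le> int m ^ L" using bounds by (metis of_nat_le_iff of_nat_power)
        moreover have "0 < int m ^ L" using bounds by simp
        ultimately show ?thesis
        proof (cases "i < D")
          case True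
          then have "0 \<le> coeff (y 0) i" "coeff (y 0) i < int N" "0 \<le> coeff (y' 0) i" "coeff (y' 0) i < int N"
            using b0 by (auto simp: box_def)
          then show ?thesis using \<open>int N \<le> int m ^ L\<close> unfolding T_def coeff_diff by linarith
        next
          case False
          then show ?thesis using b0 bounds by (simp add: box_def T_def)
        qed
      qed
      have Tc: "int m ^ (k * L) dvd coeff (G y' - G y - T ^ k) i" if "i < k * D" for i
        using w(2)[OF y'(1) line] that unfolding T_def by blast
      have dig: "(coeff (G y) (k * e) div int m ^ (k * j) + \<sigma> (e, j)) mod int m \<in> S"
        "(coeff (G y') (k * e) div int m ^ (k * j) + \<sigma> (e, j)) mod int m \<in> S" if "e < D" "j < L" for e j
        using y(2) y'(2) that by (auto simp: rel_def I_def c_def)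
      show False
        by (rule lowest_digit_conflict[where R = S and k = k and m = m and T = T and D = D and L = L
              and f = "G y" and f' = "G y'" and \<sigma> = "\<lambda>e j. \<sigma> (e, j)"])
          (fact S(2) bounds(5,6) T0 Tz Tb Tc dig)+
    qed
    ultimately show "\<exists>v\<in>vecs R n - {zero_vec R n}. punctured_line R n u v \<inter> V ` Z = {}" by blast
  qed
  ultimately show ?thesis using \<sigma>(2) unfolding cardY Z_def by (metis (no_types, lifting))
qed

end

section \<open>Matchings from squares and from higher powers\<close>

text \<open>A coefficient of the product has at most \<open>E\<close> nonzero summands, and the
  product vanishes from degree \<open>D + E - 1\<close> on; \<open>Suc i\<close> avoids truncated
  subtraction.\<close>

lemma coeff_mult_bounds:
  fixes f g :: "int poly"
  assumes f: "\<And>i. \<bar>coeff f i\<bar> \<le> a" "\<And>i. i \<ge> D \<Longrightarrow> coeff f i = 0"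
    and g: "\<And>i. \<bar>coeff g i\<bar> \<le> b" "\<And>i. i \<ge> E \<Longrightarrow> coeff g i = 0"
  shows "\<bar>coeff (f * g) i\<bar> \<le> int E * (a * b)" and "Suc i \<ge> D + E \<Longrightarrow> coeff (f * g) i = 0"
proof -
  have ab: "a \<ge> 0" "b \<ge> 0" using f(1)[of 0] g(1)[of 0] by auto
  have c: "coeff (f * g) i = (\<Sum>j\<le>i. coeff g j * coeff f (i - j))"
    by (subst mult.commute) (simp add: coeff_mult)
  also have "\<dots> = (\<Sum>j\<in>{..i} \<inter> {..<E}. coeff g j * coeff f (i - j))"
    by (rule sum.mono_neutral_right) (auto simp: g(2) not_less)
  finally have c': "coeff (f * g) i = (\<Sum>j\<in>{..i} \<inter> {..<E}. coeff g j * coeff f (i - j))" .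
  have "\<bar>coeff (f * g) i\<bar> \<le> (\<Sum>j\<in>{..i} \<inter> {..<E}. \<bar>coeff g j * coeff f (i - j)\<bar>)"
    unfolding c' by (rule sum_abs)
  also have "\<dots> \<le> (\<Sum>j\<in>{..i} \<inter> {..<E}. b * a)"
    by (rule sum_mono) (simp add: abs_mult mult_mono f g ab)
  also have "\<dots> = int (card ({..i} \<inter> {..<E})) * (a * b)" by (simp add: mult.commute)
  also have "\<dots> \<le> int E * (a * b)"
    using ab card_mono[of "{..<E}" "{..i} \<inter> {..<E}"] by (intro mult_right_mono) auto
  finally show "\<bar>coeff (f * g) i\<bar> \<le> int E * (a * b)" .
  assume i: "Suc i \<ge> D + E"
  show "coeff (f * g) i = 0"
    unfolding c' by (rule sum.neutral) (use i f(2) in auto)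
qed

lemma box_bounds:
  assumes "f \<in> box s h" and "h \<ge> 1"
  shows "\<bar>coeff f i\<bar> \<le> int (h - 1)" and "g \<in> box s h \<Longrightarrow> \<bar>coeff (g - f) i\<bar> \<le> int (h - 1)"
proof -
  have *: "0 \<le> coeff f i \<and> coeff f i \<le> int (h - 1)" if "f \<in> box s h" for f
    using that assms(2) by (cases "i < s") (force simp: box_def)+
  show "\<bar>coeff f i\<bar> \<le> int (h - 1)" using *[OF assms(1)] by linarith
  show "\<bar>coeff (g - f) i\<bar> \<le> int (h - 1)" if "g \<in> box s h"
    using *[OF assms(1)] *[OF that] unfolding coeff_diff by linarith
qed

context field
begin

text \<open>Digits of \<open>y\<close> and \<open>y'\<close> are below \<open>(p + 1) / 2\<close>
  and coefficients of \<open>W\<close> are at most \<open>p / 2\<close>, so those of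
  \<open>y' - y - W\<close> are below \<open>p\<close> in absolute value and divisibility by
  \<open>p\<close> makes them vanish.\<close>

lemma box_no_wrap:
  assumes x: "x \<in> carrier R"
    and ker: "\<And>f i. int_eval x f = \<zero> \<Longrightarrow> (\<And>j. j \<ge> t \<Longrightarrow> coeff f j = 0) \<Longrightarrow> int p dvd coeff f i"
    and y: "y \<in> box t h" "y' \<in> box t h" and h: "2 * h \<le> p + 1" "p > 0"
    and W: "\<And>i. \<bar>coeff W i\<bar> \<le> int (p div 2)" "\<And>i. i \<ge> t \<Longrightarrow> coeff W i = 0"
    and ev: "int_eval x (y' - y - W) = \<zero>"
  shows "y' = y + W"
proof (rule poly_eqI)
  fix i
  have d: "int p dvd coeff (y' - y - W) i"
    by (rule ker[OF ev]) (use y W(2) in \<open>auto simp: box_def\<close>)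
  have "\<bar>coeff (y' - y - W) i\<bar> < int p"
  proof (cases "i < t")
    case True
    then have b: "0 \<le> coeff y i" "coeff y i < int h" "0 \<le> coeff y' i" "coeff y' i < int h"
      using y by (auto simp: box_def)
    have "2 * int h \<le> int p + 1" "2 * int (p div 2) \<le> int p" using h by linarith+
    then show ?thesis using b W(1)[of i] unfolding coeff_diff by linarith
  next
    case False
    then show ?thesis using y W(2)[of i] h by (auto simp: box_def)
  qed
  then have "coeff (y' - y - W) i = 0"
    using d zdvd_imp_le[of "int p" "\<bar>coeff (y' - y - W) i\<bar>"] by fastforce
  then show "coeff y' i = coeff (y + W) i" by simp
qed

text \<open>The tangent direction to a parabola: \<open>(a + T)^2 - (b + 2 a T)\<close> exceeds
  \<open>a^2 - b\<close> by exactly \<open>T^2\<close>. The bounds on \<open>D\<close> and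
  \<open>N\<close> keep \<open>2 a T\<close> of degree below \<open>t\<close> and small enough not
  to wrap around.\<close>

lemma square_matching:
  fixes N D t L p m h :: nat
  assumes x: "x \<in> carrier R"
    and ker: "\<And>f i. int_eval x f = \<zero> \<Longrightarrow> (\<And>j. j \<ge> t \<Longrightarrow> coeff f j = 0) \<Longrightarrow> int p dvd coeff f i"
    and bounds: "2 * D \<le> t + 1" "D \<ge> 1" "N \<ge> 1" "N \<le> p" "2 * h \<le> p + 1" "h \<ge> 1" "m \<ge> 2" "N \<le> m ^ L"
      "2 * D * (N - 1)\<^sup>2 \<le> p div 2"
    and S: "S \<subseteq> {0..<int m}"
      "\<And>a b u. a \<in> S \<Longrightarrow> b \<in> S \<Longrightarrow> [b - a = u\<^sup>2] (mod int m) \<Longrightarrow> int m dvd u"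
  shows "\<exists>P. point_line_matching R 2 P \<and> N ^ D * h ^ t * card S ^ (D * L) \<le> card P * m ^ (D * L)"
proof -
  define G where "G y = (y 0)\<^sup>2 - y (1::nat)" for y :: "nat \<Rightarrow> int poly"
  have p0: "p > 0" using bounds by simp
  have "\<exists>P. point_line_matching R 2 P \<and> N ^ D * h ^ (t * (2 - 1)) * card S ^ (D * L) \<le> card P * m ^ (D * L)"
  proof (rule matching_from_digits[where k = 2 and G = G and p = p and x = x and h = h])
    fix y assume y: "y \<in> (\<Pi>\<^sub>E i\<in>{..<2::nat}. if i = 0 then box D N else box t h)"
    define w where "w i = (if i = 0 then 1 else smult 2 (y 0))" for i :: nat
    show "\<exists>w. w 0 = 1 \<and> (\<forall>y'\<in>(\<Pi>\<^sub>E i\<in>{..<2::nat}. if i = 0 then box D N else box t h).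
       (\<forall>i<2. int_eval x (y' i - y i - (y' 0 - y 0) * w i) = \<zero>) \<longrightarrow>
       (\<forall>i<2 * D. int m ^ (2 * L) dvd coeff (G y' - G y - (y' 0 - y 0)\<^sup>2) i))"
    proof (intro exI[of _ w] conjI ballI impI allI)
      show "w 0 = 1" by (simp add: w_def)
      fix y' i
      assume y': "y' \<in> (\<Pi>\<^sub>E i\<in>{..<2::nat}. if i = 0 then box D N else box t h)"
        and line: "\<forall>i<2. int_eval x (y' i - y i - (y' 0 - y 0) * w i) = \<zero>"
      define T where "T = y' 0 - y 0"
      have y0: "y 0 \<in> box D N" "y' 0 \<in> box D N" using PiE_mem[OF y, of 0] PiE_mem[OF y', of 0] by auto
      have y1: "y 1 \<in> box t h" "y' 1 \<in> box t h"
        using PiE_mem[OF y, of 1] PiE_mem[OF y', of 1] by auto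
      have c0: "\<bar>coeff (y 0) i\<bar> \<le> int (N - 1)" "\<bar>coeff T i\<bar> \<le> int (N - 1)" for i
        unfolding T_def
        using box_bounds(1)[OF y0(1) bounds(3)] box_bounds(2)[OF y0(1) bounds(3) y0(2)] by blast+
      have z0: "coeff (y 0) i = 0" "coeff T i = 0" if "i \<ge> D" for i
        using y0 that by (auto simp: box_def T_def)
      have "y' 1 = y 1 + T * smult 2 (y 0)"
      proof (rule box_no_wrap[where p = p and h = h and t = t and x = x])
        have c2: "\<bar>coeff (smult 2 (y 0)) i\<bar> \<le> 2 * int (N - 1)" for i
          using c0(1)[of i] by simp
        have z2: "coeff (smult 2 (y 0)) i = 0" if "i \<ge> D" for i
          using z0(1)[OF that] by simp
        note B = coeff_mult_bounds[of T "int (N - 1)" D "smult 2 (y 0)" "2 * int (N - 1)" D, OF c0(2) z0(2) c2 z2]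
        show "\<bar>coeff (T * smult 2 (y 0)) i\<bar> \<le> int (p div 2)" for i
        proof -
          have "int D * (int (N - 1) * (2 * int (N - 1))) = int (2 * D * (N - 1)\<^sup>2)"
            by (simp add: power2_eq_square)
          then show ?thesis using B(1)[of i] bounds(9) by linarith
        qed
        show "coeff (T * smult 2 (y 0)) i = 0" if "i \<ge> t" for i
          using B(2)[of i] that bounds(1) by simp
        show "int_eval x (y' 1 - y 1 - T * smult 2 (y 0)) = \<zero>"
          using line[rule_format, of 1] by (simp add: T_def w_def)
      qed (fact x ker y1 bounds(5) p0)+
      moreover have "y' 0 = y 0 + T" by (simp add: T_def)
      moreover have "smult 2 (y 0) = y 0 + y 0"
        by (metis one_add_one smult_1_left smult_add_left)
      ultimately have "G y' - G y - T\<^sup>2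
          = (y 0 + T)\<^sup>2 - (y 1 + T * (y 0 + y 0)) - ((y 0)\<^sup>2 - y 1) - T\<^sup>2"
        by (simp only: G_def)
      also have "\<dots> = 0"
        by (simp add: power2_eq_square distrib_left distrib_right)
      finally show "int m ^ (2 * L) dvd coeff (G y' - G y - (y' 0 - y 0)\<^sup>2) i"
        by (simp add: T_def)
    qed
  next
    show "\<And>a b u. a \<in> S \<Longrightarrow> b \<in> S \<Longrightarrow> [b - a = u\<^sup>2] (mod int m) \<Longrightarrow> int m dvd u" by (fact S(2))
    show "\<And>f i. int_eval x f = \<zero> \<Longrightarrow> (\<And>j. j \<ge> t \<Longrightarrow> coeff f j = 0) \<Longrightarrow> int p dvd coeff f i" by (fact ker)
  qed (use x S(1) bounds in simp_all)
  then show ?thesis by simp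
qed

end

text \<open>With \<open>Z(Y) = (\<Sum>j<k. z\<^sub>j Y\<^sup>j)\<close>, the \<open>\<zeta> j\<close> are the coefficients of
  \<open>(Y - x)\<^bsup>k - 1\<^esup> - (Z(Y) - Z(x)) / (Y - x)\<close>.\<close>

lemma exact_direction:
  fixes x :: "'a::comm_ring_1" and z :: "nat \<Rightarrow> 'a"
  assumes k: "k \<ge> 1"
  obtains \<zeta> where "\<And>T. (\<Sum>j<k. (z j + T * \<zeta> j) * (x + T) ^ j) = (\<Sum>j<k. z j * x ^ j) + T ^ k"
proof -
  define Z where "Z = (\<Sum>j<k. monom (z j) j)"
  define Q where "Q = synthetic_div Z x"
  define W where "W = [:- x, 1:] ^ (k - 1) - Q"
  have sum: "poly f a = (\<Sum>j<k. coeff f j * a ^ j)" if "degree f \<le> k - 1" for f and a :: 'a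
    unfolding poly_altdef using that k coeff_eq_0[of f]
    by (intro sum.mono_neutral_left) auto
  have dZ: "degree Z \<le> k - 1"
    unfolding Z_def by (intro degree_sum_le) (auto intro: order.trans[OF degree_monom_le])
  have cZ: "coeff Z j = z j" if "j < k" for j
    using that by (simp add: Z_def coeff_sum coeff_monom if_distrib sum.delta cong: if_cong)
  have dW: "degree W \<le> k - 1"
    unfolding W_def Q_def
    using dZ degree_power_le[of "[:- x, 1:]" "k - 1"]
    by (intro degree_diff_le) (auto simp: degree_synthetic_div)
  show thesis
  proof (rule that[of "coeff W"])
    fix T
    \<comment> \<open>At \<open>Y = x + T\<close> the divisor \<open>Y - x\<close> becomes
      \<open>T\<close>.\<close>
    have Q: "T * poly Q (x + T) = poly Z (x + T) - poly Z x"
      using arg_cong[OF synthetic_div_correct'[of x Z], of "\<lambda>f. poly f (x + T)"]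
      by (simp add: Q_def algebra_simps)
    have "(\<Sum>j<k. (z j + T * coeff W j) * (x + T) ^ j) = poly Z (x + T) + T * poly W (x + T)"
      by (simp add: sum[OF dZ] sum[OF dW] cZ distrib_right sum.distrib sum_distrib_left mult.assoc)
    also have "T * poly W (x + T) = T ^ k - T * poly Q (x + T)"
      using k by (cases k) (simp_all add: W_def algebra_simps)
    finally show "(\<Sum>j<k. (z j + T * coeff W j) * (x + T) ^ j) = (\<Sum>j<k. z j * x ^ j) + T ^ k"
      using sum[OF dZ, of x] Q by (simp add: cZ)
  qed
qed

lemma smult_sum_right: "smult c (\<Sum>i\<in>I. f i) = (\<Sum>i\<in>I. smult c (f i))"
  by (induction I rule: infinite_finite_induct) (auto simp: smult_add_right)

lemma coeff_digits:
  fixes f :: "int poly"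
  assumes "\<And>i. 0 \<le> coeff f i \<and> coeff f i < int M ^ B" and M: "M > 0"
  shows "\<exists>\<phi>. (\<forall>b i. 0 \<le> coeff (\<phi> b) i \<and> coeff (\<phi> b) i < int M) \<and> f = (\<Sum>b<B. smult (int M ^ b) (\<phi> b))"
  using assms(1)
proof (induction B arbitrary: f)
  case 0
  then have "f = 0" by (intro poly_eqI) (metis coeff_0 less_one linorder_not_less order_antisym power_0 zless_imp_add1_zle add_0)
  then show ?case using M by (intro exI[of _ "\<lambda>_. 0"]) auto
next
  case (Suc B)
  define r where "r = map_poly (\<lambda>c. c mod int M) f"
  define q where "q = map_poly (\<lambda>c. c div int M) f"
  have r: "coeff r i = coeff f i mod int M" for i by (simp add: r_def coeff_map_poly)
  have q: "coeff q i = coeff f i div int M" for i by (simp add: q_def coeff_map_poly)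
  have "0 \<le> coeff q i \<and> coeff q i < int M ^ B" for i
  proof -
    have "int M * (coeff f i div int M) \<le> coeff f i"
      using M pos_mod_sign[of "int M" "coeff f i"] mult_div_mod_eq[of "int M" "coeff f i"] by linarith
    also have "\<dots> < int M * int M ^ B" using Suc.prems[of i] by simp
    finally show ?thesis
      using Suc.prems[of i] M by (simp add: q pos_imp_zdiv_nonneg_iff)
  qed
  from Suc.IH[OF this] obtain \<phi> where \<phi>: "\<And>b i. 0 \<le> coeff (\<phi> b) i \<and> coeff (\<phi> b) i < int M"
    "q = (\<Sum>b<B. smult (int M ^ b) (\<phi> b))" by blast
  have "f = r + smult (int M) q" by (rule poly_eqI) (simp add: r q)
  also have "\<dots> = (\<Sum>b<Suc B. smult (int M ^ b) (case b of 0 \<Rightarrow> r | Suc b \<Rightarrow> \<phi> b))"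
    unfolding \<phi>(2) by (subst sum.lessThan_Suc_shift) (simp add: smult_sum_right)
  finally have "f = (\<Sum>b<Suc B. smult (int M ^ b) (case_nat r \<phi> b))" .
  moreover have "0 \<le> coeff (case_nat r \<phi> b) i \<and> coeff (case_nat r \<phi> b) i < int M" for b i
    using \<phi>(1) M by (cases b) (simp_all add: r)
  ultimately show ?case by blast
qed

lemma poly_segments:
  fixes f :: "'a::comm_ring_1 poly"
  shows "f = (\<Sum>a<A. monom 1 (a * E) * poly_cutoff E (poly_shift (a * E) f))
    + monom 1 (A * E) * poly_shift (A * E) f"
proof (induction A)
  case (Suc A)
  have "poly_shift (A * E) f = poly_cutoff E (poly_shift (A * E) f) + monom 1 E * poly_shift (Suc A * E) f"
    by (rule poly_eqI) (auto simp: coeff_poly_cutoff coeff_poly_shift coeff_monom_mult add.assoc add.commute)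
  then have "monom 1 (A * E) * poly_shift (A * E) f = monom 1 (A * E) * poly_cutoff E (poly_shift (A * E) f)
      + monom 1 (A * E) * monom 1 E * poly_shift (Suc A * E) f"
    by (metis distrib_left mult.assoc)
  then show ?case
    using Suc by (simp add: mult_monom add.commute add.left_commute)
qed simp

text \<open>Reduction modulo \<open>Q\<close>, base \<open>M\<close> expansion and cutting into
  blocks of length \<open>E\<close> express \<open>f\<close> by short, small polynomials with
  weights independent of \<open>f\<close>. The weights can be built into \<open>G\<close>, and the
  small pieces become entries of a direction; the remainders with \<open>u\<close> and
  \<open>v\<close> are meant to fall outside the digits in use.\<close>

lemma small_digits:
  fixes f :: "int poly" and M :: nat
  assumes M: "M > 0" and Q: "Q > 0" "Q \<le> int M ^ B"
  obtains \<phi> u v where "\<And>a b. \<phi> a b \<in> box E M"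
    and "f = (\<Sum>(a, b)\<in>{..<A} \<times> {..<B}. monom (int M ^ b) (a * E) * \<phi> a b) + monom 1 (A * E) * u + smult Q v"
proof -
  define r where "r = map_poly (\<lambda>c. c mod Q) f"
  define v where "v = map_poly (\<lambda>c. c div Q) f"
  have r: "coeff r i = coeff f i mod Q" for i by (simp add: r_def coeff_map_poly)
  have v: "coeff v i = coeff f i div Q" for i by (simp add: v_def coeff_map_poly)
  have f: "f = r + smult Q v" by (rule poly_eqI) (simp add: r v)
  have "0 \<le> coeff r i \<and> coeff r i < int M ^ B" for i
    using Q pos_mod_bound[of Q "coeff f i"] pos_mod_sign[of Q "coeff f i"] unfolding r by linarith
  from coeff_digits[OF this M] obtain \<psi> where \<psi>: "\<And>b i. 0 \<le> coeff (\<psi> b) i \<and> coeff (\<psi> b) i < int M"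
    "r = (\<Sum>b<B. smult (int M ^ b) (\<psi> b))" by blast
  define \<phi> where "\<phi> a b = poly_cutoff E (poly_shift (a * E) (\<psi> b))" for a b
  define u where "u = (\<Sum>b<B. smult (int M ^ b) (poly_shift (A * E) (\<psi> b)))"
  have "r = (\<Sum>b<B. smult (int M ^ b) ((\<Sum>a<A. monom 1 (a * E) * \<phi> a b) + monom 1 (A * E) * poly_shift (A * E) (\<psi> b)))"
    unfolding \<psi>(2) \<phi>_def by (intro sum.cong refl arg_cong[where f = "smult _"] poly_segments)
  also have "\<dots> = (\<Sum>b<B. \<Sum>a<A. monom (int M ^ b) (a * E) * \<phi> a b) + monom 1 (A * E) * u"
    by (simp add: u_def smult_add_right smult_sum_right sum.distrib sum_distrib_left smult_monom flip: mult_smult_left)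
  also have "(\<Sum>b<B. \<Sum>a<A. monom (int M ^ b) (a * E) * \<phi> a b)
      = (\<Sum>(a, b)\<in>{..<A} \<times> {..<B}. monom (int M ^ b) (a * E) * \<phi> a b)"
    by (subst sum.swap) (simp add: sum.cartesian_product)
  finally have "r = (\<Sum>(a, b)\<in>{..<A} \<times> {..<B}. monom (int M ^ b) (a * E) * \<phi> a b) + monom 1 (A * E) * u" .
  then have "f = (\<Sum>(a, b)\<in>{..<A} \<times> {..<B}. monom (int M ^ b) (a * E) * \<phi> a b)
      + monom 1 (A * E) * u + smult Q v" using f by simp
  moreover have "\<phi> a b \<in> box E M" for a b
    using \<psi>(1) by (auto simp: \<phi>_def box_def coeff_poly_cutoff coeff_poly_shift)
  ultimately show thesis using that by blast
qed

context field
begin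

text \<open>The polynomial \<open>z\<^sub>j\<close> of the header is spread over the coordinates \<open>idx (j, (a, b))\<close> with
  weights \<open>M ^ b\<close> times the monomial of degree \<open>a * E\<close>.\<close>

lemma power_matching:
  fixes N D E t k A B L M p m h :: nat
  assumes x: "x \<in> carrier R"
    and ker: "\<And>f i. int_eval x f = \<zero> \<Longrightarrow> (\<And>j. j \<ge> t \<Longrightarrow> coeff f j = 0) \<Longrightarrow> int p dvd coeff f i"
    and bounds: "k \<ge> 1" "D + E \<le> t + 1" "E \<ge> 1" "k * D \<le> A * E" "N \<ge> 1" "N \<le> p" "2 * h \<le> p + 1"
      "m \<ge> 2" "N \<le> m ^ L" "M \<ge> 1" "m ^ (k * L) \<le> M ^ B" "E * ((N - 1) * (M - 1)) \<le> p div 2"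
    and S: "S \<subseteq> {0..<int m}"
      "\<And>a b u. a \<in> S \<Longrightarrow> b \<in> S \<Longrightarrow> [b - a = u ^ k] (mod int m) \<Longrightarrow> int m dvd u"
  shows "\<exists>P. point_line_matching R (Suc (k * (A * B))) P \<and>
    N ^ D * h ^ (t * (k * (A * B))) * card S ^ (D * L) \<le> card P * m ^ (D * L)"
proof -
  define C where "C = {..<A} \<times> {..<B}"
  define n where "n = Suc (k * (A * B))"
  define \<mu> where "\<mu> c = (case c of (a, b) \<Rightarrow> monom (int M ^ b) (a * E))" for c
  define Q where "Q = int m ^ (k * L)"
  have "card ({..<k} \<times> C) = card {1..<n}"
    by (simp add: C_def n_def card_cartesian_product)
  then obtain idx where "bij_betw idx ({..<k} \<times> C) {1..<n}"
    using finite_same_card_bij[of "{..<k} \<times> C" "{1..<n}"] by (auto simp: C_def)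
  then have idx: "inj_on idx ({..<k} \<times> C)" "\<And>j c. j < k \<Longrightarrow> c \<in> C \<Longrightarrow> idx (j, c) \<in> {1..<n}"
    by (auto simp: bij_betw_def)
  define z where "z y j = (\<Sum>c\<in>C. \<mu> c * y (idx (j, c)))" for y :: "nat \<Rightarrow> int poly" and j
  define G where "G y = (\<Sum>j<k. z y j * y 0 ^ j)" for y
  have p0: "p > 0" using bounds by simp
  have "\<exists>P. point_line_matching R n P \<and> N ^ D * h ^ (t * (n - 1)) * card S ^ (D * L) \<le> card P * m ^ (D * L)"
  proof (rule matching_from_digits[where k = k and G = G and p = p and x = x and h = h])
    fix y assume y: "y \<in> (\<Pi>\<^sub>E i\<in>{..<n}. if i = 0 then box D N else box t h)"
    obtain \<zeta> where \<zeta>: "\<And>T. (\<Sum>j<k. (z y j + T * \<zeta> j) * (y 0 + T) ^ j) = (\<Sum>j<k. z y j * y 0 ^ j) + T ^ k"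
      using exact_direction[OF bounds(1)] by blast
    have Q: "Q > 0" "Q \<le> int M ^ B"
      using bounds by (auto simp: Q_def of_nat_le_iff simp flip: of_nat_power)
    have "\<exists>\<phi> u v. (\<forall>c. \<phi> c \<in> box E M) \<and> \<zeta> j = (\<Sum>c\<in>C. \<mu> c * \<phi> c) + monom 1 (A * E) * u + smult Q v" for j
    proof -
      obtain \<phi> u v where "\<And>a b. \<phi> a b \<in> box E M"
        "\<zeta> j = (\<Sum>(a, b)\<in>C. monom (int M ^ b) (a * E) * \<phi> a b) + monom 1 (A * E) * u + smult Q v"
        using small_digits[of M Q B E "\<zeta> j" A thesis] Q bounds(10) unfolding C_def by auto
      then show ?thesis
        by (intro exI[of _ "\<lambda>(a, b). \<phi> a b"] exI[of _ u] exI[of _ v]) (auto simp: \<mu>_def case_prod_beta)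
    qed
    then obtain \<phi> u v where \<phi>: "\<And>j c. \<phi> j c \<in> box E M"
      and \<zeta>_eq: "\<And>j. \<zeta> j = (\<Sum>c\<in>C. \<mu> c * \<phi> j c) + monom 1 (A * E) * u j + smult Q (v j)"
      by metis
    define w where "w i = (if i = 0 then 1 else case inv_into ({..<k} \<times> C) idx i of (j, c) \<Rightarrow> \<phi> j c)" for i
    have w_idx: "w (idx (j, c)) = \<phi> j c" if "j < k" "c \<in> C" for j c
      using idx(2)[OF that] inv_into_f_f[OF idx(1), of "(j, c)"] that by (simp add: w_def)
    show "\<exists>w. w 0 = 1 \<and> (\<forall>y'\<in>(\<Pi>\<^sub>E i\<in>{..<n}. if i = 0 then box D N else box t h).
       (\<forall>i<n. int_eval x (y' i - y i - (y' 0 - y 0) * w i) = \<zero>) \<longrightarrow>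
       (\<forall>i<k * D. int m ^ (k * L) dvd coeff (G y' - G y - (y' 0 - y 0) ^ k) i))"
    proof (intro exI[of _ w] conjI ballI impI allI)
      show "w 0 = 1" by (simp add: w_def)
      fix y' i
      assume y': "y' \<in> (\<Pi>\<^sub>E i\<in>{..<n}. if i = 0 then box D N else box t h)"
        and line: "\<forall>i<n. int_eval x (y' i - y i - (y' 0 - y 0) * w i) = \<zero>" and i: "i < k * D"
      define T where "T = y' 0 - y 0"
      have y0: "y 0 \<in> box D N" "y' 0 \<in> box D N"
        using PiE_mem[OF y, of 0] PiE_mem[OF y', of 0] by (auto simp: n_def)
      \<comment> \<open>The pieces are small, so their products with \<open>T\<close> do not wrap
        around and these coordinates move as integer polynomials.\<close>
      have step: "y' (idx (j, c)) = y (idx (j, c)) + T * \<phi> j c" if jc: "j < k" "c \<in> C" for j c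
      proof (rule box_no_wrap[where p = p and h = h and t = t and x = x])
        show "y (idx (j, c)) \<in> box t h" "y' (idx (j, c)) \<in> box t h"
          using PiE_mem[OF y, of "idx (j, c)"] PiE_mem[OF y', of "idx (j, c)"] idx(2)[OF jc] by auto
        have T1: "\<bar>coeff T i\<bar> \<le> int (N - 1)" for i
          unfolding T_def using box_bounds(2)[OF y0(1) bounds(5) y0(2)] .
        have T2: "coeff T i = 0" if "i \<ge> D" for i
          using y0 that by (auto simp: box_def T_def)
        have \<phi>1: "\<bar>coeff (\<phi> j c) i\<bar> \<le> int (M - 1)" for i
          using box_bounds(1)[OF \<phi> bounds(10)] .
        have \<phi>2: "coeff (\<phi> j c) i = 0" if "i \<ge> E" for i
          using \<phi>[of j c] that by (auto simp: box_def)
        note B = coeff_mult_bounds[of T "int (N - 1)" D "\<phi> j c" "int (M - 1)" E, OF T1 T2 \<phi>1 \<phi>2]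
        show "\<bar>coeff (T * \<phi> j c) i\<bar> \<le> int (p div 2)" for i
        proof -
          have "int E * (int (N - 1) * int (M - 1)) \<le> int (p div 2)"
            using bounds(12) by (metis of_nat_le_iff of_nat_mult)
          then show ?thesis using B(1)[of i] by linarith
        qed
        show "coeff (T * \<phi> j c) i = 0" if "i \<ge> t" for i
          using B(2)[of i] that bounds(2) by simp
        show "int_eval x (y' (idx (j, c)) - y (idx (j, c)) - T * \<phi> j c) = \<zero>"
          using line[rule_format, of "idx (j, c)"] idx(2)[OF jc] w_idx[OF jc] by (simp add: T_def)
      qed (fact x ker bounds(7) p0)+
      define U where "U = (\<Sum>j<k. u j * (y 0 + T) ^ j)"
      define V where "V = (\<Sum>j<k. v j * (y 0 + T) ^ j)"
      have zj: "z y' j = z y j + T * \<zeta> j - T * (monom 1 (A * E) * u j + smult Q (v j))" if "j < k" for j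
      proof -
        have "z y' j = (\<Sum>c\<in>C. \<mu> c * (y (idx (j, c)) + T * \<phi> j c))"
          unfolding z_def by (rule sum.cong) (use step that in auto)
        also have "\<dots> = z y j + T * (\<Sum>c\<in>C. \<mu> c * \<phi> j c)"
          by (simp add: z_def distrib_left sum.distrib sum_distrib_left mult.left_commute)
        finally show ?thesis by (simp add: \<zeta>_eq distrib_left)
      qed
      have "G y' = (\<Sum>j<k. (z y j + T * \<zeta> j) * (y 0 + T) ^ j
          - T * (monom 1 (A * E) * (u j * (y 0 + T) ^ j) + smult Q (v j * (y 0 + T) ^ j)))"
        unfolding G_def by (rule sum.cong) (simp_all add: zj T_def left_diff_distrib distrib_right distrib_left mult.assoc)
      also have "\<dots> = (\<Sum>j<k. (z y j + T * \<zeta> j) * (y 0 + T) ^ j) - T * (monom 1 (A * E) * U + smult Q V)"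
        by (simp add: sum_subtractf sum.distrib sum_distrib_left distrib_left U_def V_def smult_sum_right)
      also have "\<dots> = G y + T ^ k - T * (monom 1 (A * E) * U + smult Q V)"
        unfolding \<zeta> by (simp add: G_def)
      finally have "G y' - G y - T ^ k = monom 1 (A * E) * (- T * U) + smult Q (- T * V)"
        by (simp add: algebra_simps)
      \<comment> \<open>Degrees below \<open>k * D\<close> lie below \<open>A * E\<close>, so the
        truncated high part is not seen; the other error is a multiple of \<open>Q\<close>.\<close>
      moreover have "coeff (monom 1 (A * E) * (- T * U)) i = 0"
        using i bounds(4) by (simp add: coeff_monom_mult)
      ultimately have "coeff (G y' - G y - T ^ k) i = Q * coeff (- T * V) i"
        by (simp only: coeff_add coeff_smult)
      then show "int m ^ (k * L) dvd coeff (G y' - G y - (y' 0 - y 0) ^ k) i"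
        by (simp add: T_def Q_def)
    qed
  next
    show "\<And>a b u. a \<in> S \<Longrightarrow> b \<in> S \<Longrightarrow> [b - a = u ^ k] (mod int m) \<Longrightarrow> int m dvd u" by (fact S(2))
    show "\<And>f i. int_eval x f = \<zero> \<Longrightarrow> (\<And>j. j \<ge> t \<Longrightarrow> coeff f j = 0) \<Longrightarrow> int p dvd coeff f i" by (fact ker)
  qed (use x S(1) bounds in \<open>simp_all add: n_def\<close>)
  then show ?thesis by (simp add: n_def)
qed

end

section \<open>Residues without power differences\<close>

text \<open>The name refers to differences: no two distinct members differ by a square modulo
  \<open>205 = 5 * 41\<close>. The relevant exponent \<open>log 12 / log 205\<close> is slightly
  above 0.4668.\<close>

definition square_free_digits :: "int set" where
  "square_free_digits = {0, 2, 8, 14, 77, 79, 85, 96, 103, 109, 111, 181}"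

lemma card_square_free_digits: "card square_free_digits = 12"
  by (simp add: square_free_digits_def)

lemma square_free_digits_difference:
  assumes "a \<in> square_free_digits" "b \<in> square_free_digits" "[b - a = u\<^sup>2] (mod 205)"
  shows "205 dvd u"
proof -
  \<comment> \<open>\<open>?Q\<close> lists the squares of the nonzero residues. It omits 0, so the
    case \<open>a = b\<close> also forces \<open>u\<close> to vanish modulo 205.\<close>
  let ?Q = "[1, 4, 5, 9, 10, 16, 20, 21, 25, 31, 36, 39, 40, 41, 45, 46, 49, 50, 51, 59, 61, 64,
      66, 74, 80, 81, 84, 86, 90, 91, 100, 105, 114, 115, 119, 121, 124, 125, 131, 139, 141,
      144, 146, 154, 155, 156, 159, 160, 164, 165, 166, 169, 174, 180, 184, 185, 189, 195,
      196, 200, 201, 204] :: int list"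
  let ?S = "[0, 2, 8, 14, 77, 79, 85, 96, 103, 109, 111, 181] :: int list"
  have sq: "list_all (\<lambda>r. r * r mod 205 \<in> set ?Q) [1..204]"
    by code_simp
  have diff: "list_all (\<lambda>a. list_all (\<lambda>b. (b - a) mod 205 \<notin> set ?Q) ?S) ?S"
    by code_simp
  have "a \<in> set ?S" "b \<in> set ?S"
    using assms(1,2) unfolding square_free_digits_def by simp_all
  then have "(b - a) mod 205 \<notin> set ?Q"
    using diff unfolding list_all_iff by blast
  moreover define r where "r = u mod 205"
  have "(b - a) mod 205 = r * r mod 205"
    using assms(3) by (simp add: cong_def r_def power2_eq_square mod_simps)
  ultimately have "r \<notin> {1..204}"
    using sq unfolding list_all_iff by (metis set_upto)
  moreover have "0 \<le> r" "r < 205" by (simp_all add: r_def)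
  ultimately have "r = 0" by simp
  then show ?thesis by (simp add: r_def dvd_eq_mod_eq_0)
qed

lemma fermat_int:
  assumes "Factorial_Ring.prime (r::nat)" "\<not> int r dvd u"
  shows "[u ^ (r - 1) = 1] (mod int r)"
proof -
  define a where "a = nat (u mod int r)"
  have r0: "r > 0" using assms(1) by (rule prime_gt_0_nat)
  then have a: "int a = u mod int r" by (simp add: a_def)
  then have "\<not> r dvd a" using assms(2) by (metis dvd_mod_iff int_dvd_int_iff dvd_refl)
  then have "[a ^ (r - 1) = 1] (mod r)" using fermat_theorem assms(1) by blast
  then have "[int a ^ (r - 1) = 1] (mod int r)" by (metis cong_int_iff of_nat_1 of_nat_power)
  moreover have "[u ^ (r - 1) = int a ^ (r - 1)] (mod int r)"
    by (rule cong_pow) (simp add: a cong_def)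
  ultimately show ?thesis by (rule cong_trans[rotated])
qed

text \<open>For odd \<open>r\<close> these are 0, 2, ..., \<open>r - 3\<close>. The residue
  \<open>r - 1\<close> is left out because \<open>0 - (r - 1)\<close> is 1 modulo
  \<open>r\<close>.\<close>

definition even_digits :: "nat \<Rightarrow> int set" where
  "even_digits r = (\<lambda>i. 2 * int i) ` {..<(r - 1) div 2}"

lemma card_even_digits: "card (even_digits r) = (r - 1) div 2"
  unfolding even_digits_def by (subst card_image) (auto simp: inj_on_def)

lemma even_digits_subset: "even_digits r \<subseteq> {0..<int r}"
  by (auto simp: even_digits_def)

text \<open>By Fermat the \<open>(r - 1)\<close>-th power of a unit is 1, while
  \<open>b - a - 1\<close> is odd and at most \<open>r - 2\<close> in absolute value, hence not
  divisible by \<open>r\<close>.\<close>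

lemma even_digits_difference:
  assumes r: "Factorial_Ring.prime (r::nat)" "r \<ge> 3"
    and ab: "a \<in> even_digits r" "b \<in> even_digits r" "[b - a = u ^ (r - 1)] (mod int r)"
  shows "int r dvd u"
proof (rule ccontr)
  assume nd: "\<not> int r dvd u"
  obtain i j where ij: "a = 2 * int i" "i < (r - 1) div 2" "b = 2 * int j" "j < (r - 1) div 2"
    using ab(1,2) by (auto simp: even_digits_def)
  have "[b - a = 1] (mod int r)"
    using ab(3) fermat_int[OF r(1) nd] by (rule cong_trans)
  then have "int r dvd b - a - 1" by (simp add: cong_iff_dvd_diff)
  then obtain c where c: "b - a - 1 = int r * c" by (rule dvdE)
  have "odd (b - a - 1)" by (simp add: ij)
  then have "c \<noteq> 0" using c by auto
  then have "int r * 1 \<le> int r * \<bar>c\<bar>" by (intro mult_left_mono) auto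
  then have "int r \<le> \<bar>b - a - 1\<bar>" using c by (simp add: abs_mult)
  moreover have "2 * int i \<le> int r - 3" "2 * int j \<le> int r - 3" using ij r(2) by linarith+
  ultimately show False using ij by linarith
qed

section \<open>Size estimates\<close>

lemma exists_digit_length:
  assumes "m \<ge> 2" "N \<ge> (1::nat)"
  obtains L where "N \<le> m ^ L" "m ^ L \<le> m * N"
proof -
  define L where "L = (LEAST L. N \<le> m ^ L)"
  have "N \<le> m ^ N" using assms by (meson less_exp less_imp_le order.trans power_mono zero_le)
  then have 1: "N \<le> m ^ L" unfolding L_def by (rule LeastI)
  have "m ^ L \<le> m * N"
  proof (cases L)
    case 0
    then show ?thesis using assms by (simp add: Suc_le_eq)
  next
    case (Suc L')
    then have "\<not> N \<le> m ^ L'" using not_less_Least[of L' "\<lambda>L. N \<le> m ^ L"] unfolding L_def by simp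
    then show ?thesis using Suc by simp
  qed
  then show thesis using that 1 by blast
qed

text \<open>Each digit position costs a factor \<open>s / m >= m powr (\<kappa> - 1)\<close>. Over
  \<open>L\<close> positions, \<open>m ^ L <= m * N\<close> makes this at least
  \<open>(m * N) powr (\<kappa> - 1) >= N powr (\<kappa> - 1) / m\<close>.\<close>

lemma matching_size_bound:
  fixes N D H L m s P :: nat and \<kappa> :: real
  assumes N: "N \<ge> 1" and m: "m \<ge> 2" "m ^ L \<le> m * N" and \<kappa>: "0 \<le> \<kappa>" "\<kappa> \<le> 1" "real m powr \<kappa> \<le> real s"
    and P: "N ^ D * H * s ^ (D * L) \<le> P * m ^ (D * L)"
  shows "real P \<ge> real H * (real N powr \<kappa> / real m) ^ D"
proof -
  have "real N powr \<kappa> / real m \<le> real N * (real s / real m) ^ L"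
  proof -
    have "real N powr \<kappa> / real m = real N * (real N powr (\<kappa> - 1) / real m)"
      using N by (simp add: powr_diff)
    also have "real N powr (\<kappa> - 1) / real m \<le> (real m * real N) powr (\<kappa> - 1)"
    proof -
      have "real m powr (-1) \<le> real m powr (\<kappa> - 1)" using m \<kappa> by (intro powr_mono) auto
      then have "real N powr (\<kappa> - 1) * real m powr (-1) \<le> real N powr (\<kappa> - 1) * real m powr (\<kappa> - 1)"
        by (intro mult_left_mono) auto
      then show ?thesis using m N by (simp add: powr_mult powr_minus_divide mult.commute)
    qed
    also have "\<dots> \<le> (real m ^ L) powr (\<kappa> - 1)"
    proof (rule powr_mono2')
      show "real m ^ L \<le> real m * real N" using m(2) by (metis of_nat_le_iff of_nat_mult of_nat_power)
    qed (use m \<kappa> in auto)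
    also have "\<dots> = (real m powr \<kappa> / real m) ^ L"
    proof -
      have "(real m ^ L) powr (\<kappa> - 1) = (real m powr (\<kappa> - 1)) ^ L"
        using m by (simp add: powr_power flip: powr_realpow) (simp add: powr_powr mult.commute)
      then show ?thesis using m by (simp add: powr_diff)
    qed
    also have "\<dots> \<le> (real s / real m) ^ L"
      using m \<kappa>(3) by (intro power_mono divide_right_mono) auto
    finally show ?thesis using N by (simp add: mult_left_mono)
  qed
  then have "(real N powr \<kappa> / real m) ^ D \<le> (real N * (real s / real m) ^ L) ^ D"
    by (intro power_mono) auto
  also have "\<dots> = real N ^ D * real s ^ (D * L) / real m ^ (D * L)"
    by (simp add: power_mult_distrib power_divide power_mult[symmetric] mult.commute)
  finally have "real H * (real N powr \<kappa> / real m) ^ D \<le> real H * (real N ^ D * real s ^ (D * L) / real m ^ (D * L))"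
    by (rule mult_left_mono) simp
  also have "\<dots> \<le> real P"
  proof -
    have "real (N ^ D * H * s ^ (D * L)) \<le> real (P * m ^ (D * L))" using P by (simp only: of_nat_le_iff)
    then show ?thesis using m by (simp add: field_simps)
  qed
  finally show ?thesis .
qed

lemma powr_quotient_le:
  fixes a b i j :: nat
  assumes "a ^ i \<le> b ^ j" "a > 0" "b > 0" "j > 0"
  shows "real a powr (real i / real j) \<le> real b"
proof -
  have "real a ^ i \<le> real b ^ j"
    using assms(1) by (metis of_nat_le_iff of_nat_power)
  then have "(real a powr real i) powr (1 / real j) \<le> (real b powr real j) powr (1 / real j)"
    using assms by (intro powr_mono2) (auto simp: powr_realpow)
  then show ?thesis using assms by (simp add: powr_powr)
qed

lemma powr_205: "205 powr (0.4668::real) \<le> 12"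
proof -
  \<comment> \<open>\<open>204 / 437\<close> lies between \<open>0.4668\<close> and \<open>log 205 12\<close>; the comparison of the
    corresponding powers is composed from two comparisons of small numerals.\<close>
  have "a ^ 204 \<le> b ^ 437"
    if 1: "a ^ 7 * u \<le> b ^ 15 * v" and 2: "a * v ^ 29 \<le> b\<^sup>2 * u ^ 29" and "u > 0" "v > 0" for a b u v :: nat
  proof -
    have "(a ^ 7 * u) ^ 29 * (a * v ^ 29) \<le> (b ^ 15 * v) ^ 29 * (b\<^sup>2 * u ^ 29)"
      by (intro mult_mono power_mono 1 2) auto
    also have "(a ^ 7 * u) ^ 29 * (a * v ^ 29) = a ^ 204 * (u ^ 29 * v ^ 29)"
      by (simp add: power_mult_distrib flip: power_mult) (simp flip: power_Suc2)
    also have "(b ^ 15 * v) ^ 29 * (b\<^sup>2 * u ^ 29) = b ^ 437 * (u ^ 29 * v ^ 29)"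
      by (simp add: power_mult_distrib flip: power_mult)
    finally show ?thesis using that by simp
  qed
  note compose = this
  \<comment> \<open>\<open>81 / 80\<close> is at most \<open>12 ^ 15 / 205 ^ 7\<close>, and its 29th
    power is at least \<open>205 / 12 ^ 2\<close>; moreover \<open>7 * 29 + 1 = 204\<close> and
    \<open>15 * 29 + 2 = 437\<close>.\<close>
  have "(205::nat) ^ 204 \<le> 12 ^ 437"
    by (rule compose[of 205 81 12 80]) simp_all
  from powr_quotient_le[OF this] have "205 powr (204 / 437::real) \<le> 12" by simp
  moreover have "205 powr 0.4668 \<le> 205 powr (204 / 437::real)" by (rule powr_mono) simp_all
  ultimately show ?thesis by linarith
qed

lemma nikodym_number_le_real:
  assumes "is_GF q F" "n < d" "point_line_matching F n P"
  shows "real (nikodym_number d F) \<le> real q ^ d - real (card P) * real q ^ (d - n)"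
proof -
  have "nikodym_number d F + card P * q ^ (d - n) \<le> q ^ d"
    using assms by (intro nikodym_number_le) (auto simp: is_GF_def)
  then have "real (nikodym_number d F + card P * q ^ (d - n)) \<le> real (q ^ d)" by (simp only: of_nat_le_iff)
  then show ?thesis by simp
qed

section \<open>Dimension three\<close>

text \<open>Each of the \<open>D >= t / 2\<close> coefficients of the first coordinate ranges up to
  about \<open>sqrt p\<close> and retains the exponent 0.4668; the second coordinate loses a
  constant factor only, and the free third one contributes \<open>q\<close>.\<close>

lemma nikodym_3:
  fixes t :: nat
  assumes t: "t \<ge> 1"
  shows "\<exists>c::real. c > 0 \<and> (\<forall>(p::nat) (q::nat) F. Factorial_Ring.prime p \<and> q = p ^ t \<and> is_GF q F \<longrightarrow>
    real (nikodym_number 3 F) \<le> real q ^ 3 - c * real q powr 2.1167)"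
proof -
  \<comment> \<open>The largest \<open>D\<close> for which products of two polynomials of degree
    below \<open>D\<close> have degree below \<open>t\<close>.\<close>
  define D where "D = (t + 1) div 2"
  define c where "c = (1 / 2) ^ t * ((1 / (4 * real D)) powr 0.2334 / 205) ^ D"
  have D: "D \<ge> 1" "2 * D \<le> t + 1" "t \<le> 2 * D" using t by (auto simp: D_def)
  have "c > 0" using D by (simp add: c_def)
  moreover have "real (nikodym_number 3 F) \<le> real q ^ 3 - c * real q powr 2.1167"
    if p: "Factorial_Ring.prime p" and q: "q = p ^ t" and F: "is_GF q F" for p q F
  proof -
    interpret F: field F using F by (simp add: is_GF_def)
    obtain x where x: "x \<in> carrier F"
      "\<And>f i. F.int_eval x f = \<zero>\<^bsub>F\<^esub> \<Longrightarrow> (\<And>j. j \<ge> t \<Longrightarrow> coeff f j = 0) \<Longrightarrow> int p dvd coeff f i"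
      using F.int_eval_kernel[OF p, of t] F q unfolding is_GF_def by metis
    have p2: "p \<ge> 2" using p by (rule prime_ge_2_nat)
    \<comment> \<open>The largest integer with \<open>4 * D * a^2 <= p\<close>, the condition
      against wrap-around for digits up to \<open>a = N - 1\<close>.\<close>
    define a where "a = nat \<lfloor>sqrt (real p / (4 * real D))\<rfloor>"
    define h where "h = (p + 1) div 2"
    define N where "N = Suc a"
    have "real a \<le> sqrt (real p / (4 * real D))" by (simp add: a_def)
    then have "(real a)\<^sup>2 \<le> (sqrt (real p / (4 * real D)))\<^sup>2" by (rule power_mono) simp
    then have "(real a)\<^sup>2 \<le> real p / (4 * real D)" by simp
    then have "real (4 * D * a\<^sup>2) \<le> real p" using D by (simp add: field_simps)
    then have aD: "4 * D * a\<^sup>2 \<le> p" by (simp only: of_nat_le_iff)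
    have "4 * (a * a) \<le> 4 * D * a\<^sup>2" using D by (simp add: power2_eq_square)
    moreover have "a \<le> a * a" by simp
    ultimately have "4 * a \<le> p" using aD by linarith
    then have Np: "N \<le> p" using p2 by (simp add: N_def)
    have N_ge: "real N \<ge> (real p / (4 * real D)) powr (1 / 2)"
      unfolding N_def a_def by (simp add: powr_half_sqrt) linarith
    obtain L where L: "N \<le> 205 ^ L" "205 ^ L \<le> 205 * N"
      using exists_digit_length[of 205 N] by (auto simp: N_def)
    have "\<exists>P. point_line_matching F 2 P \<and> N ^ D * h ^ t * card square_free_digits ^ (D * L) \<le> card P * 205 ^ (D * L)"
    proof (rule F.square_matching[where x = x and p = p])
      show "\<And>f i. F.int_eval x f = \<zero>\<^bsub>F\<^esub> \<Longrightarrow> (\<And>j. j \<ge> t \<Longrightarrow> coeff f j = 0) \<Longrightarrow> int p dvd coeff f i"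
        by (fact x(2))
      show "\<And>a b u. a \<in> square_free_digits \<Longrightarrow> b \<in> square_free_digits \<Longrightarrow> [b - a = u\<^sup>2] (mod int 205) \<Longrightarrow> int 205 dvd u"
        using square_free_digits_difference by simp
      show "2 * D * (N - 1)\<^sup>2 \<le> p div 2" using aD by (simp add: N_def)
      show "square_free_digits \<subseteq> {0..<int 205}" by (simp add: square_free_digits_def)
    qed (use x(1) D Np L p2 in \<open>auto simp: N_def h_def\<close>)
    then obtain P where P: "point_line_matching F 2 P" "N ^ D * h ^ t * 12 ^ (D * L) \<le> card P * 205 ^ (D * L)"
      by (auto simp: card_square_free_digits)
    have size: "real (card P) \<ge> real (h ^ t) * (real N powr 0.4668 / real 205) ^ D"
      by (rule matching_size_bound[where L = L and s = 12]) (use P(2) L(2) powr_205 in \<open>simp_all add: N_def\<close>)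
    have h_ge: "(real p / 2) ^ t \<le> real (h ^ t)"
      unfolding of_nat_power by (intro power_mono) (auto simp: h_def)
    have N_pow: "(real p powr 0.2334 * ((1 / (4 * real D)) powr 0.2334 / 205)) ^ D \<le> (real N powr 0.4668 / real 205) ^ D"
    proof (rule power_mono)
      have "(real p / (4 * real D)) powr 0.2334 = ((real p / (4 * real D)) powr (1 / 2)) powr 0.4668"
        by (simp add: powr_powr)
      also have "\<dots> \<le> real N powr 0.4668" by (rule powr_mono2) (use N_ge in auto)
      finally have "(real p / (4 * real D)) powr 0.2334 \<le> real N powr 0.4668" .
      moreover have "(real p / (4 * real D)) powr 0.2334 = real p powr 0.2334 * (1 / (4 * real D)) powr 0.2334"
        by (simp flip: powr_mult)
      ultimately show "real p powr 0.2334 * ((1 / (4 * real D)) powr 0.2334 / 205) \<le> real N powr 0.4668 / real 205"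
        by simp
    qed simp
    have "(real p / 2) ^ t * (real p powr 0.2334 * ((1 / (4 * real D)) powr 0.2334 / 205)) ^ D
        \<le> real (h ^ t) * (real N powr 0.4668 / real 205) ^ D"
      by (rule mult_mono[OF h_ge N_pow]) auto
    also note size
    also have "(real p / 2) ^ t * (real p powr 0.2334 * ((1 / (4 * real D)) powr 0.2334 / 205)) ^ D
        = c * (real p ^ t * real p powr (0.2334 * real D))"
      using p2 by (simp add: c_def power_mult_distrib power_divide powr_realpow powr_powr flip: powr_realpow)
    finally have 1: "real (card P) \<ge> c * (real p ^ t * real p powr (0.2334 * real D))" .
    have "real q powr 2.1167 = real p powr (2.1167 * real t)"
      using p2 by (simp add: q powr_powr mult.commute flip: powr_realpow)
    \<comment> \<open>\<open>D >= t / 2\<close> gives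
      \<open>0.2334 * D >= 0.1167 * t\<close>.\<close>
    also have "\<dots> \<le> real p powr (real t + 0.2334 * real D + real t)"
      using D p2 by (intro powr_mono) auto
    also have "\<dots> = (real p ^ t * real p powr (0.2334 * real D)) * real q"
      using p2 unfolding powr_add by (simp add: powr_realpow q)
    finally have "c * real q powr 2.1167 \<le> c * ((real p ^ t * real p powr (0.2334 * real D)) * real q)"
      using \<open>c > 0\<close> by simp
    also have "\<dots> \<le> real (card P) * real q"
      using mult_right_mono[OF 1, of "real q"] by (simp add: mult.assoc)
    finally show ?thesis
      using nikodym_number_le_real[OF F _ P(1), of 3] by simp
  qed
  ultimately show ?thesis by blast
qed

section \<open>High dimension\<close>

text \<open>The source of the term \<open>2 log t / log p\<close>: for \<open>q = p ^ t\<close>,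
  \<open>t powr (2 * t)\<close> is \<open>q powr (2 * ln t / ln p)\<close>. It absorbs a loss
  \<open>t ^ t\<close> and, by \<open>b ^ t <= exp b * t ^ t\<close>, also \<open>b ^ t\<close>, up
  to a constant independent of \<open>t\<close>.\<close>

lemma exp_powr_le_inverse_power:
  fixes t :: nat and b :: real
  assumes "t \<ge> 1" "b > 0"
  shows "exp (- b) * real t powr (- 2 * real t) \<le> 1 / (b * real t) ^ t"
proof -
  have "(b / t) ^ t \<le> exp (b / t) ^ t"
    using assms exp_ge_add_one_self[of "b / t"] by (intro power_mono) (linarith, simp)
  also have "\<dots> = exp b"
    using assms by (simp flip: exp_of_nat_mult)
  finally have "(b * t) ^ t \<le> exp b * (real t ^ t * real t ^ t)"
    using assms by (simp add: power_divide power_mult_distrib field_simps)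
  also have "real t ^ t * real t ^ t = real t powr (2 * real t)"
    using assms unfolding mult_2 powr_add by (simp add: powr_realpow)
  finally have "(b * t) ^ t \<le> exp b * real t powr (2 * real t)" .
  then have "inverse (exp b * real t powr (2 * real t)) \<le> inverse ((b * t) ^ t)"
    using assms by (intro le_imp_inverse_le) auto
  then show ?thesis
    by (simp add: exp_minus powr_minus inverse_eq_divide)
qed

text \<open>The first term comes from digit sets of density at least one third; the second from
  shrinking both the number and the size of the coefficients of the first coordinate, as
  \<open>(1 - 1 / r)^2 >= 1 - 2 / r\<close>.\<close>

definition loss :: "nat \<Rightarrow> real" where
  "loss r = ln 3 / ln (real r) + 2 / real r"

lemma nikodym_large_dimension:
  fixes r d p t q :: nat
  assumes r: "Factorial_Ring.prime r" "r \<ge> 3" and d: "1 + 2 * r ^ 5 < d"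
    and p: "Factorial_Ring.prime p" and t: "t \<ge> 1" and q: "q = p ^ t" and F: "is_GF q F"
  shows "real (nikodym_number d F) \<le> real q ^ d
    - exp (- (4 * real r * 2 ^ d)) * real q powr (real d - loss r - 2 * ln (real t) / ln (real p))"
proof -
  interpret F: field F using F by (simp add: is_GF_def)
  obtain x where x: "x \<in> carrier F"
    "\<And>f i. F.int_eval x f = \<zero>\<^bsub>F\<^esub> \<Longrightarrow> (\<And>j. j \<ge> t \<Longrightarrow> coeff f j = 0) \<Longrightarrow> int p dvd coeff f i"
    using F.int_eval_kernel[OF p, of t] F q unfolding is_GF_def by metis
  have p2: "p \<ge> 2" using p by (rule prime_ge_2_nat)
  define k where "k = r - 1"
  \<comment> \<open>\<open>A\<close> blocks of length \<open>E\<close> cover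
    \<open>k * D <= k * r * E\<close> degrees. \<open>B\<close> digits suffice because
    \<open>r\<close> and \<open>p\<close> are at most \<open>M ^ r\<close>, so
    \<open>r ^ (k * L) <= (r * p) ^ k <= M ^ B\<close>.\<close>
  define A where "A = k * r"
  define B where "B = 2 * k * r"
  \<comment> \<open>\<open>t / r\<close> rounded up. With \<open>D + E = t + 1\<close> the products
    of a first-coordinate increment and a direction entry have degree below
    \<open>t\<close>.\<close>
  define E where "E = (t + r - 1) div r"
  define D where "D = t + 1 - E"
  \<comment> \<open>\<open>p powr (1 / r)\<close> rounded up; \<open>a\<close> is then the largest
    integer with \<open>2 * t * M * a <= p\<close>, which prevents wrap-around.\<close>
  define M where "M = (LEAST M. p \<le> M ^ r)"
  define a where "a = p div (2 * t * M)"
  define N where "N = Suc a"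
  define h where "h = (p + 1) div 2"
  define w where "w = k * (A * B)"
  have k: "k \<ge> 1" "k = r - 1" using r(2) by (auto simp: k_def)

  have "p \<le> p ^ r" using r(2) p2 by (intro self_le_power) auto
  then have M: "p \<le> M ^ r" unfolding M_def by (rule LeastI)
  have M2: "M \<ge> 2"
  proof (rule ccontr)
    assume "\<not> M \<ge> 2"
    then have "M = 0 \<or> M = 1" by auto
    then have "M ^ r \<le> 1" using r(2) by (auto simp: power_0_left)
    then show False using M p2 by simp
  qed
  have M_less: "(M - 1) ^ r < p"
    using not_less_Least[of "M - 1" "\<lambda>M. p \<le> M ^ r"] M2 unfolding M_def[symmetric] by simp
  have M_le: "real M \<le> 2 * real p powr (1 / real r)"
  proof -
    have "real (M - 1) ^ r \<le> real p"
      using M_less by (metis less_imp_le of_nat_le_iff of_nat_power)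
    then have "(real (M - 1) powr real r) powr (1 / real r) \<le> real p powr (1 / real r)"
      using M2 by (intro powr_mono2) (auto simp: powr_realpow)
    then have "real (M - 1) \<le> real p powr (1 / real r)"
      using r(2) M2 by (simp add: powr_powr)
    then show ?thesis using M2 by linarith
  qed

  have E_ge: "t \<le> r * E"
  proof -
    have "t + r - 1 < r * Suc E" unfolding E_def using r(2) by (metis dividend_less_div_times mult.commute mult_Suc_right add.commute not_gr_zero not_numeral_le_zero)
    then show ?thesis by simp
  qed
  have E1: "E \<ge> 1" using E_ge t by (cases E) auto
  have rE: "r * E \<le> t + r - 1" unfolding E_def by (rule times_div_less_eq_dividend)
  have Et: "E \<le> t"
  proof -
    have "t + r - 1 \<le> r * t"
      using t r(2) by (cases t; cases r) auto
    then have "r * E \<le> r * t" using rE by linarith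
    then show ?thesis using r(2) by simp
  qed
  have D: "D + E = t + 1" "D \<ge> 1" "D \<le> t" using Et E1 by (auto simp: D_def)
  have D_ge: "real D \<ge> real t * (1 - 1 / real r)"
  proof -
    have "real r * real E \<le> real t + real r - 1"
      using rE r(2) t by (metis (mono_tags) One_nat_def of_nat_1 of_nat_add of_nat_diff of_nat_le_iff of_nat_mult trans_le_add1)
    then have "real E \<le> (real t + real r - 1) / real r"
      using r(2) by (simp add: pos_le_divide_eq mult.commute)
    also have "\<dots> \<le> real t / real r + 1" using r(2) by (simp add: field_simps)
    finally have "real E \<le> real t / real r + 1" .
    moreover have "real D + real E = real t + 1" using D(1) by (metis of_nat_1 of_nat_add)
    ultimately show ?thesis by (simp add: algebra_simps)
  qed

  have ap: "2 * t * M * a \<le> p" unfolding a_def by (rule times_div_less_eq_dividend)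
  have "4 * a \<le> 2 * t * M * a"
    using t M2 mult_le_mono[of 1 t 2 M] by (intro mult_le_mono1) (simp add: mult.commute)
  then have Np: "N \<le> p" using ap p2 unfolding N_def by linarith
  have N_ge: "real N \<ge> real p powr (1 - 1 / real r) / (4 * real t)"
  proof -
    have "p < (2 * t * M) * Suc a"
      using t M2 unfolding a_def by (metis div_less_iff_less_mult lessI mult.commute mult_pos_pos pos2 zero_less_iff_neq_zero less_le_trans One_nat_def Suc_le_eq)
    then have "real p \<le> real ((2 * t * M) * N)" unfolding N_def by (simp only: of_nat_le_iff less_imp_le)
    also have "\<dots> = 2 * real t * real N * real M" by simp
    also have "\<dots> \<le> 2 * real t * real N * (2 * real p powr (1 / real r))"
      by (intro mult_left_mono M_le) simp
    finally have "real p \<le> (4 * real t) * real N * real p powr (1 / real r)" by simp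
    then show ?thesis using p2 t by (simp add: powr_diff field_simps)
  qed
  obtain L where L: "N \<le> r ^ L" "r ^ L \<le> r * N"
    using exists_digit_length[of r N] r(2) by (auto simp: N_def)

  have "\<exists>P. point_line_matching F (Suc (k * (A * B))) P \<and>
    N ^ D * h ^ (t * (k * (A * B))) * card (even_digits r) ^ (D * L) \<le> card P * r ^ (D * L)"
  proof (rule F.power_matching[where x = x and p = p and E = E and M = M])
    show "\<And>f i. F.int_eval x f = \<zero>\<^bsub>F\<^esub> \<Longrightarrow> (\<And>j. j \<ge> t \<Longrightarrow> coeff f j = 0) \<Longrightarrow> int p dvd coeff f i"
      by (fact x(2))
    show "\<And>a b u. a \<in> even_digits r \<Longrightarrow> b \<in> even_digits r \<Longrightarrow> [b - a = u ^ k] (mod int r) \<Longrightarrow> int r dvd u"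
      unfolding k_def using even_digits_difference[OF r] by blast
    show "even_digits r \<subseteq> {0..<int r}" by (rule even_digits_subset)
    show "k * D \<le> A * E"
    proof -
      have "k * D \<le> k * (r * E)" using D(3) E_ge by (intro mult_le_mono2) simp
      then show ?thesis by (simp add: A_def mult.assoc)
    qed
    show "r ^ (k * L) \<le> M ^ B"
    proof -
      have "r ^ (k * L) = (r ^ L) ^ k" by (simp add: power_mult mult.commute flip: power_mult)
      also have "\<dots> \<le> (r * p) ^ k" using L(2) Np by (intro power_mono) (meson le_trans mult_le_mono2, simp)
      also have "r * p \<le> M ^ r * M ^ r"
      proof (rule mult_le_mono)
        have "r \<le> 2 ^ r" using less_exp[of r] by simp
        also have "2 ^ r \<le> M ^ r" using M2 by (intro power_mono) auto
        finally show "r \<le> M ^ r" .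
      qed (rule M)
      also have "(M ^ r * M ^ r) ^ k = M ^ B"
        by (simp add: B_def mult.commute mult.left_commute flip: power_mult power_add mult_2)
      finally show ?thesis by (simp add: power_mono)
    qed
    show "E * ((N - 1) * (M - 1)) \<le> p div 2"
    proof -
      have "E * ((N - 1) * (M - 1)) \<le> t * (a * M)"
        unfolding N_def using Et by (intro mult_le_mono) auto
      moreover have "2 * (t * (a * M)) \<le> p" using ap by (simp add: ac_simps)
      ultimately show ?thesis by linarith
    qed
  qed (use x(1) k D E1 Np L p2 r(2) M2 in \<open>auto simp: N_def h_def\<close>)
  then obtain P where P: "point_line_matching F (Suc w) P"
      "N ^ D * h ^ (t * w) * ((r - 1) div 2) ^ (D * L) \<le> card P * r ^ (D * L)"
    by (auto simp: card_even_digits w_def)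

  \<comment> \<open>Chosen so that \<open>r powr \<kappa> = r / 3\<close>, which is at most
    \<open>(r - 1) / 2\<close> for \<open>r >= 3\<close>.\<close>
  define \<kappa> where "\<kappa> = 1 - ln 3 / ln (real r)"
  have lnr: "ln 3 \<le> ln (real r)" "ln (3::real) > 0" "ln (real r) > 0" using r(2) by auto
  have \<kappa>: "0 \<le> \<kappa>" "\<kappa> \<le> 1" using lnr by (auto simp: \<kappa>_def)
  have "real r powr (ln 3 / ln (real r)) = 3" using r(2) lnr by (simp add: powr_def)
  then have "real r powr \<kappa> = real r / 3" using r(2) unfolding \<kappa>_def powr_diff by simp
  moreover have "real ((r - 1) div 2) = (real r - 1) / 2"
    using prime_odd_nat[OF r(1)] r(2) by (subst real_of_nat_div) (auto simp: of_nat_diff)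
  ultimately have r\<kappa>: "real r powr \<kappa> \<le> real ((r - 1) div 2)" using r(2) by simp
  have size: "real (h ^ (t * w)) * (real N powr \<kappa> / real r) ^ D \<le> real (card P)"
    by (rule matching_size_bound[OF _ _ L(2) \<kappa> r\<kappa> P(2)]) (use r(2) in \<open>auto simp: N_def\<close>)
  have h_ge: "(real p / 2) ^ (t * w) \<le> real (h ^ (t * w))"
    unfolding of_nat_power by (intro power_mono) (auto simp: h_def)
  define \<nu> where "\<nu> = real p powr (1 - 1 / real r) / (4 * real t)"
  have \<nu>: "\<nu> > 0" "\<nu> \<le> real N" using N_ge p2 t by (auto simp: \<nu>_def)
  \<comment> \<open>A lower bound for \<open>\<kappa> * D\<close>. As \<open>\<nu>\<close> may be
    below 1, the exponent is raised to \<open>\<kappa> * D\<close> only after passing to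
    \<open>N >= 1\<close>.\<close>
  define \<eta> where "\<eta> = \<kappa> * real t * (1 - 1 / real r)"
  have \<eta>: "0 \<le> \<eta>" "\<eta> \<le> real t" "\<eta> \<le> \<kappa> * real D"
  proof -
    show "0 \<le> \<eta>" using \<kappa> r(2) by (simp add: \<eta>_def)
    have "\<kappa> * (1 - 1 / real r) \<le> 1 * 1" using \<kappa> r(2) by (intro mult_mono) auto
    then show "\<eta> \<le> real t" using t mult_left_mono[of "\<kappa> * (1 - 1 / real r)" 1 "real t"] by (simp add: \<eta>_def ac_simps)
    show "\<eta> \<le> \<kappa> * real D" using mult_left_mono[OF D_ge \<kappa>(1)] by (simp add: \<eta>_def ac_simps)
  qed
  have N_pow: "\<nu> powr \<eta> \<le> (real N powr \<kappa>) ^ D"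
  proof -
    have "\<nu> powr \<eta> \<le> real N powr \<eta>" using \<nu> \<eta> by (intro powr_mono2) auto
    also have "\<dots> \<le> real N powr (\<kappa> * real D)" using \<eta> by (intro powr_mono) (auto simp: N_def)
    also have "\<dots> = (real N powr \<kappa>) ^ D"
      by (simp add: N_def powr_powr flip: powr_realpow)
    finally show ?thesis .
  qed
  have \<nu>_pow: "real q powr (1 - loss r) / (4 * real t) ^ t \<le> \<nu> powr \<eta>"
  proof -
    have "\<nu> powr \<eta> = real p powr ((1 - 1 / real r) * \<eta>) / (4 * real t) powr \<eta>"
      by (simp add: \<nu>_def powr_divide powr_powr)
    moreover have "(4 * real t) powr \<eta> \<le> (4 * real t) ^ t"
    proof -
      have "(4 * real t) powr \<eta> \<le> (4 * real t) powr real t" using \<eta> t by (intro powr_mono) auto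
      then show ?thesis using t by (simp add: powr_realpow)
    qed
    moreover have "real q powr (1 - loss r) \<le> real p powr ((1 - 1 / real r) * \<eta>)"
    proof -
      define s where "s = 1 / real r"
      have s: "0 \<le> s" "s \<le> 1" using r(2) by (auto simp: s_def)
      have "\<kappa> * (1 - s)\<^sup>2 \<ge> \<kappa> * (1 - 2 * s)"
        using \<kappa> by (intro mult_left_mono) (auto simp: power2_diff)
      moreover have "\<kappa> * (2 * s) \<le> 1 * (2 * s)" using \<kappa> s by (intro mult_right_mono) auto
      moreover have "\<kappa> * (1 - 2 * s) = \<kappa> - \<kappa> * (2 * s)" by (simp add: algebra_simps)
      moreover have "1 - loss r = \<kappa> - 2 * s" by (simp add: loss_def \<kappa>_def s_def)
      ultimately have "1 - loss r \<le> \<kappa> * (1 - s)\<^sup>2" by linarith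
      then have "real t * (1 - loss r) \<le> real t * (\<kappa> * (1 - s)\<^sup>2)" by (intro mult_left_mono) auto
      then have "real p powr (real t * (1 - loss r)) \<le> real p powr ((1 - 1 / real r) * \<eta>)"
        using p2 by (intro powr_mono) (auto simp: \<eta>_def s_def power2_eq_square ac_simps)
      then show ?thesis using p2 by (simp add: q powr_powr flip: powr_realpow)
    qed
    ultimately show ?thesis using t by (auto intro!: frac_le)
  qed
  have r_pow: "real r ^ D \<le> real r ^ t" using D(3) r(2) by (intro power_increasing) auto
  \<comment> \<open>At most \<open>2 * r ^ 5\<close> coordinates carry the split \<open>z\<close>;
    one more is the first coordinate, and at least one has to stay free.\<close>
  have wd: "Suc w < d"
  proof -
    have "w = 2 * (k ^ 3 * r\<^sup>2)" by (simp add: w_def A_def B_def power3_eq_cube power2_eq_square)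
    also have "\<dots> \<le> 2 * (r ^ 3 * r\<^sup>2)" using k by (intro mult_le_mono2 mult_le_mono1 power_mono) auto
    also have "\<dots> = 2 * r ^ 5" by (simp flip: power_add)
    finally show ?thesis using d by simp
  qed
  \<comment> \<open>\<open>b * t\<close> bounds the loss per factor of the \<open>t\<close>-th
    power: \<open>2 ^ w <= 2 ^ d\<close> from the halved boxes, \<open>4 * t\<close> from
    \<open>N\<close> and \<open>r\<close> from rounding the digit length.\<close>
  define b where "b = 4 * real r * 2 ^ d"
  have b0: "b > 0" using r(2) by (simp add: b_def)
  have q0: "real q > 0" using p2 by (simp add: q)
  have "exp (- b) * real q powr (real d - loss r - 2 * ln (real t) / ln (real p))
      = exp (- b) * real t powr (- 2 * real t) * (real q powr (real d - loss r))"
  proof -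
    have "real q powr (2 * ln (real t) / ln (real p)) = real t powr (2 * real t)"
      using p2 t by (simp add: q powr_def ln_realpow)
    then show ?thesis by (simp add: powr_diff powr_minus divide_inverse)
  qed
  also have "\<dots> \<le> 1 / (b * real t) ^ t * real q powr (real d - loss r)"
    by (intro mult_right_mono exp_powr_le_inverse_power t b0) auto
  also have "real q powr (real d - loss r) = real q ^ w * real q powr (1 - loss r) * real q ^ (d - Suc w)"
  proof -
    have exponent: "real d - loss r = real w + (1 - loss r) + real (d - Suc w)" using wd by simp
    show ?thesis unfolding exponent powr_add using q0 by (simp add: powr_realpow)
  qed
  also have "1 / (b * real t) ^ t * \<dots>
      \<le> (real p / 2) ^ (t * w) * ((real q powr (1 - loss r) / (4 * real t) ^ t) / real r ^ t) * real q ^ (d - Suc w)"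
  proof -
    have "(2 ^ w) ^ t * ((4 * real t) ^ t * real r ^ t) \<le> (b * real t) ^ t"
    proof -
      have "2 ^ w * (4 * real t * real r) \<le> b * real t"
      proof -
        have "(2::real) ^ w \<le> 2 ^ d" using wd by (intro power_increasing) auto
        then have "2 ^ w * (4 * real t * real r) \<le> 2 ^ d * (4 * real t * real r)" by (intro mult_right_mono) auto
        then show ?thesis by (simp add: b_def ac_simps)
      qed
      then have "(2 ^ w * (4 * real t * real r)) ^ t \<le> (b * real t) ^ t" by (intro power_mono) auto
      then show ?thesis by (simp add: power_mult_distrib mult.assoc)
    qed
    then have "1 / (b * real t) ^ t \<le> 1 / ((2 ^ w) ^ t * ((4 * real t) ^ t * real r ^ t))"
      using t r(2) b0 by (intro divide_left_mono mult_pos_pos zero_less_power) auto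
    then have "1 / (b * real t) ^ t * (real q ^ w * real q powr (1 - loss r) * real q ^ (d - Suc w))
       \<le> 1 / ((2 ^ w) ^ t * ((4 * real t) ^ t * real r ^ t)) * (real q ^ w * real q powr (1 - loss r) * real q ^ (d - Suc w))"
      by (intro mult_right_mono) auto
    also have "\<dots> = (real p / 2) ^ (t * w) * ((real q powr (1 - loss r) / (4 * real t) ^ t) / real r ^ t) * real q ^ (d - Suc w)"
      by (simp add: q power_divide power_mult mult.commute[of t w] flip: power_mult)
    finally show ?thesis .
  qed
  also have "\<dots> \<le> real (card P) * real q ^ (d - Suc w)"
  proof (rule mult_right_mono)
    have "(real p / 2) ^ (t * w) * ((real q powr (1 - loss r) / (4 * real t) ^ t) / real r ^ t)
        \<le> real (h ^ (t * w)) * ((real N powr \<kappa>) ^ D / real r ^ D)"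
      using h_ge \<nu>_pow N_pow r_pow r(2)
      by (intro mult_mono frac_le) auto
    then show "(real p / 2) ^ (t * w) * ((real q powr (1 - loss r) / (4 * real t) ^ t) / real r ^ t) \<le> real (card P)"
      using size by (simp add: power_divide)
  qed simp
  finally show ?thesis
    using nikodym_number_le_real[OF F wd P(1)] unfolding b_def by linarith
qed

section \<open>Choice of the prime\<close>

text \<open>Euclid's bound is enough: for \<open>n\<close> about \<open>(log d)^(1/4)\<close> some
  prime \<open>r > n\<close> is at most
  \<open>n! + 1 <= 2 * exp (n^2) <= 2 * exp (sqrt (log d))\<close>, whose fifth power is far below
  \<open>d\<close>, while \<open>log r\<close> is at least a quarter of
  \<open>log log d\<close>.\<close>

lemma eventually_good_prime:
  "\<forall>\<^sub>F d::nat in at_top. \<exists>r. Factorial_Ring.prime r \<and> r \<ge> 3 \<and> 1 + 2 * r ^ 5 < d \<and> loss r \<le> 16 * inverse (ln (ln (real d)))"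
proof -
  have "\<forall>\<^sub>F d::nat in at_top. 1 + 2 * (2 * exp (sqrt (ln (real d)))) ^ 5 < real d"
    by real_asymp
  moreover have "\<forall>\<^sub>F d::nat in at_top. ln (real d) powr (1 / 4) \<ge> 3" by real_asymp
  moreover have "\<forall>\<^sub>F d::nat in at_top. ln (ln (real d)) > 0" by real_asymp
  moreover have "\<forall>\<^sub>F d::nat in at_top. ln (real d) > 0" by real_asymp
  ultimately show ?thesis
  proof eventually_elim
    case (elim d)
    define n where "n = nat \<lfloor>ln (real d) powr (1 / 4)\<rfloor>"
    obtain r where r: "Factorial_Ring.prime r" "n < r" "r \<le> fact n + 1"
      using next_prime_bound by blast
    have n: "real n \<le> ln (real d) powr (1 / 4)" "n \<ge> 3" "ln (real d) powr (1 / 4) \<le> real (Suc n)"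
      unfolding n_def using elim(2) by (linarith, simp add: le_nat_floor, linarith)
    have "real r \<le> fact n + 1" using r(3) by (metis of_nat_1 of_nat_add of_nat_fact of_nat_le_iff)
    also have "\<dots> \<le> 2 * real n ^ n"
    proof -
      have "fact n \<le> real (n ^ n)" using fact_le_power[of n] by simp
      moreover have "1 \<le> real n ^ n" using n(2) by (intro one_le_power) auto
      ultimately show ?thesis by simp
    qed
    also have "real n ^ n \<le> exp (real n) ^ n"
      using exp_ge_add_one_self[of "real n"] by (intro power_mono) linarith+
    also have "exp (real n) ^ n = exp ((real n)\<^sup>2)"
      by (simp add: power2_eq_square flip: exp_of_nat_mult)
    also have "\<dots> \<le> exp (sqrt (ln (real d)))"
    proof -
      have "(real n)\<^sup>2 \<le> (ln (real d) powr (1 / 4))\<^sup>2" using n by (intro power_mono) auto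
      also have "\<dots> = sqrt (ln (real d))" using elim(4) by (simp add: powr_power powr_half_sqrt)
      finally show ?thesis by simp
    qed
    finally have "real r \<le> 2 * exp (sqrt (ln (real d)))" by simp
    then have "real r ^ 5 \<le> (2 * exp (sqrt (ln (real d)))) ^ 5" by (intro power_mono) auto
    then have "1 + 2 * real r ^ 5 < real d" using elim(1) by linarith
    then have "real (1 + 2 * r ^ 5) < real d" by simp
    then have big: "1 + 2 * r ^ 5 < d" by (simp only: of_nat_less_iff)
    have r3: "r \<ge> 3" using r(2) n(2) by simp
    have "ln (real d) powr (1 / 4) \<le> real r" using n(3) r(2) by linarith
    then have "ln (ln (real d) powr (1 / 4)) \<le> ln (real r)"
      using elim by (intro ln_mono) auto
    then have lnr: "ln (ln (real d)) / 4 \<le> ln (real r)" using elim(4) by (simp add: ln_powr)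
    \<comment> \<open>Both terms of \<open>loss r\<close> are at most \<open>2 / ln r\<close>; the
      quarter in the bound for \<open>ln r\<close> turns the resulting 4 into 16.\<close>
    have "ln (3::real) \<le> 2" using ln_le_minus_one[of "3::real"] by simp
    then have "ln 3 / ln (real r) \<le> 2 / ln (real r)" using r3 by (intro divide_right_mono) auto
    moreover have "2 / real r \<le> 2 / ln (real r)"
      using r3 ln_le_minus_one[of "real r"] by (intro divide_left_mono) auto
    ultimately have "loss r \<le> 4 / ln (real r)" unfolding loss_def by simp
    also have "\<dots> \<le> 4 / (ln (ln (real d)) / 4)"
      using lnr elim(3) by (intro divide_left_mono mult_pos_pos) auto
    also have "\<dots> = 16 * inverse (ln (ln (real d)))" by (simp add: field_simps)
    finally show ?case using r(1) r3 big by (intro exI[of _ r] conjI)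
  qed
qed

theorem theorem1p10:
  "(\<forall>t::nat. t \<ge> 1 \<longrightarrow>
      (\<exists>c::real. c > 0 \<and>
        (\<forall>(p::nat) (q::nat) F. Factorial_Ring.prime p \<and> q = p ^ t \<and> odd q \<and> is_GF q F \<longrightarrow>
           real (nikodym_number 3 F) \<le> real q ^ 3 - c * real q powr 2.1167)))
   \<and>
   (\<exists>(C::real) (D::nat) (\<epsilon>::nat \<Rightarrow> real) (c::nat \<Rightarrow> real).
      C > 0 \<and> D \<ge> 3 \<and>
      (\<forall>d\<ge>D. c d > 0 \<and> \<epsilon> d \<le> C * inverse (ln (ln (real d)))) \<and>
      (\<forall>d\<ge>D. \<forall>(p::nat) (t::nat) (q::nat) F.
         Factorial_Ring.prime p \<and> t \<ge> 1 \<and> q = p ^ t \<and> is_GF q F \<longrightarrow>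
         real (nikodym_number d F) \<le>
           real q ^ d - c d * real q powr (real d - \<epsilon> d - 2 * ln (real t) / ln (real p))))"
proof (rule conjI)
  show "\<forall>t::nat. t \<ge> 1 \<longrightarrow>
      (\<exists>c::real. c > 0 \<and>
        (\<forall>(p::nat) (q::nat) F. Factorial_Ring.prime p \<and> q = p ^ t \<and> odd q \<and> is_GF q F \<longrightarrow>
           real (nikodym_number 3 F) \<le> real q ^ 3 - c * real q powr 2.1167))"
    using nikodym_3 by meson
next
  obtain D0 where D0: "\<And>d. d \<ge> D0 \<Longrightarrow> \<exists>r. Factorial_Ring.prime r \<and> r \<ge> 3 \<and> 1 + 2 * r ^ 5 < d \<and>
      loss r \<le> 16 * inverse (ln (ln (real d)))"
    using eventually_good_prime unfolding eventually_at_top_linorder by blast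
  \<comment> \<open>The prime is fixed as a function of \<open>d\<close> alone, so that the exponent
    and the constant do not depend on \<open>p\<close> and \<open>t\<close>.\<close>
  define \<rho> where "\<rho> d = (SOME r. Factorial_Ring.prime r \<and> r \<ge> 3 \<and> 1 + 2 * r ^ 5 < d \<and>
      loss r \<le> 16 * inverse (ln (ln (real d))))" for d
  have \<rho>: "Factorial_Ring.prime (\<rho> d)" "\<rho> d \<ge> 3" "1 + 2 * \<rho> d ^ 5 < d"
    "loss (\<rho> d) \<le> 16 * inverse (ln (ln (real d)))" if "d \<ge> D0" for d
    using someI_ex[OF D0[OF that]] unfolding \<rho>_def by blast+
  show "\<exists>(C::real) (D::nat) (\<epsilon>::nat \<Rightarrow> real) (c::nat \<Rightarrow> real).
      C > 0 \<and> D \<ge> 3 \<and>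
      (\<forall>d\<ge>D. c d > 0 \<and> \<epsilon> d \<le> C * inverse (ln (ln (real d)))) \<and>
      (\<forall>d\<ge>D. \<forall>(p::nat) (t::nat) (q::nat) F.
         Factorial_Ring.prime p \<and> t \<ge> 1 \<and> q = p ^ t \<and> is_GF q F \<longrightarrow>
         real (nikodym_number d F) \<le>
           real q ^ d - c d * real q powr (real d - \<epsilon> d - 2 * ln (real t) / ln (real p)))"
    using \<rho> nikodym_large_dimension
    by (intro exI[of _ 16] exI[of _ "max 3 D0"] exI[of _ "\<lambda>d. loss (\<rho> d)"]
        exI[of _ "\<lambda>d. exp (- (4 * real (\<rho> d) * 2 ^ d))"] conjI allI impI) auto
qed

end
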